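(* For every positive integer $n$, the statistics $(\mathrm{des}, Id, \mathrm{F}, \mathrm{MAJ}, \mathrm{STAT})$ and $(\mathrm{des}, Id, \mathrm{F}, \mathrm{STAT}, \mathrm{MAJ})$ have the same joint distribution on $\mathcal{S}_n$. That is, for every tuple $(d,S,f,a,b)$, the number of $\pi\in\mathcal{S}_n$ with $(\mathrm{des}\,\pi, Id(\pi), \mathrm{F}\,\pi, \mathrm{MAJ}\,\pi, \mathrm{STAT}\,\pi)=(d,S,f,a,b)$ equals the number of $\pi\in\mathcal{S}_n$ with $(\mathrm{des}\,\pi, Id(\pi), \mathrm{F}\,\pi, \mathrm{STAT}\,\pi, \mathrm{MAJ}\,\pi)=(d,S,f,a,b)$.
   Context: $\mathcal{S}_n$ is the set of permutations $\pi=\pi_1\cdots\pi_n$ of $\{1,\dots,n\}$ in one-line notation. Define: the descent set $D(\pi)=\{i: 1\le i<n,\ \pi_i>\pi_{i+1}\}$; $\mathrm{des}\,\pi=|D(\pi)|$; $\mathrm{MAJ}\,\pi=\sum_{i\in D(\pi)} i$; $\mathrm{F}\,\pi=\pi_1$; the inverse descent set $Id(\pi)=\{k: 1\le k<n,\ k+1 \text{ appears to the left of } k \text{ in } \pi\}$; and $\mathrm{STAT}\,\pi = \mathrm{des}\,\pi + \#\{(i,j): 1\le i,\ i+1<j\le n,\ \pi_{i+1}<\pi_i<\pi_j\} + \#\{(i,j): i+1<j,\ \pi_i<\pi_j<\pi_{i+1}\} + \#\{(i,j): i+1<j,\ \pi_j<\pi_{i+1}<\pi_i\}$ (i.e. the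 sum of the numbers of occurrences of the vincular patterns $\underline{21}$, $\underline{21}3$, $\underline{13}2$, $\underline{32}1$, where underlined letters must be adjacent in $\pi$). *)

theory Defs
  imports Main "HOL-Combinatorics.Permutations"
begin

(* The word \<pi>\<^sub>1 ... \<pi>\<^sub>n is encoded as the function i \<mapsto> \<pi> i with "\<pi> permutes {1..n}".
   As "permutes" forces \<pi> i = i outside {1..n}, every word corresponds to exactly one function. *)

definition perms :: "nat \<Rightarrow> (nat \<Rightarrow> nat) set" where
  "perms n = {\<pi>. \<pi> permutes {1..n}}"

definition descent_set :: "nat \<Rightarrow> (nat \<Rightarrow> nat) \<Rightarrow> nat set" where
  "descent_set n \<pi> = {i. 1 \<le> i \<and> i < n \<and> \<pi> i > \<pi> (i + 1)}"

definition des :: "nat \<Rightarrow> (nat \<Rightarrow> nat) \<Rightarrow> nat" where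
  "des n \<pi> = card (descent_set n \<pi>)"

definition MAJ :: "nat \<Rightarrow> (nat \<Rightarrow> nat) \<Rightarrow> nat" where
  "MAJ n \<pi> = (\<Sum>i\<in>descent_set n \<pi>. i)"

definition first_letter :: "(nat \<Rightarrow> nat) \<Rightarrow> nat" where
  "first_letter \<pi> = \<pi> 1"

(* The letter k stands at position "inv \<pi> k". *)
definition inverse_descent_set :: "nat \<Rightarrow> (nat \<Rightarrow> nat) \<Rightarrow> nat set" where
  "inverse_descent_set n \<pi> = {k. 1 \<le> k \<and> k < n \<and> inv \<pi> (k + 1) < inv \<pi> k}"

(* The three sets are the occurrences of the vincular patterns 21-3, 13-2 and 32-1, in which
   the first two letters are adjacent. *)
definition STAT :: "nat \<Rightarrow> (nat \<Rightarrow> nat) \<Rightarrow> nat" where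
  "STAT n \<pi> = des n \<pi>
     + card {(i, j). 1 \<le> i \<and> i + 1 < j \<and> j \<le> n \<and> \<pi> (i + 1) < \<pi> i \<and> \<pi> i < \<pi> j}
     + card {(i, j). 1 \<le> i \<and> i + 1 < j \<and> j \<le> n \<and> \<pi> i < \<pi> j \<and> \<pi> j < \<pi> (i + 1)}
     + card {(i, j). 1 \<le> i \<and> i + 1 < j \<and> j \<le> n \<and> \<pi> j < \<pi> (i + 1) \<and> \<pi> (i + 1) < \<pi> i}"

end

theory Submission
  imports Defs
begin

text \<open>Telescoping gives \<open>STAT \<pi> = (n + 1) des \<pi> - (F \<pi> - 1) - MAJ \<pi>\<close>, so it suffices to find an
  injection on the permutations with first letter \<open>k\<close> that preserves \<open>des\<close> and \<open>Id\<close> and under which the values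
  of \<open>MAJ\<close> before and after add up to \<open>(n + 1) des - (k - 1)\<close>.
  Burstein's map, which reverses the word after the first letter and complements the letters below
  \<open>k\<close> and those above \<open>k\<close> separately, does this except that it changes \<open>Id\<close>. For \<open>des\<close> and
  \<open>MAJ\<close> only two features of it matter: the positions of the letters below \<open>k\<close> are reflected, and
  so are the descent sets of the two subwords of letters below and above \<open>k\<close>. So it is enough to
  reflect the descent sets of the subwords by some bijection that keeps their inverse descent sets.
  By inclusion-exclusion this reduces to counting the permutations with \<open>D \<subseteq> A\<close> and
  \<open>Id \<subseteq> B\<close>. By standardization these are the words with a given content that increase weakly
  outside \<open>A\<close>, and for those one can just reverse the order of the runs.\<close>

section \<open>Expressing STAT by MAJ\<close>

text \<open>The sum over \<open>j\<close> stands outside because the telescoping takes place over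
  \<open>i\<close>, for a fixed last letter of the pattern.\<close>

lemma card_pairs_sum:
  "int (card {(i, j). 1 \<le> i \<and> i + 1 < j \<and> j \<le> n \<and> P i j})
     = (\<Sum>j\<in>{1..n}. \<Sum>i\<in>{1..<j - 1}. of_bool (P i j))" for n :: nat
proof -
  have "{(i, j). 1 \<le> i \<and> i + 1 < j \<and> j \<le> n \<and> P i j}
      = (\<lambda>(j, i). (i, j)) ` (SIGMA j:{1..n}. {i \<in> {1..<j - 1}. P i j})"
    by (auto simp: image_iff)
  then have "card {(i, j). 1 \<le> i \<and> i + 1 < j \<and> j \<le> n \<and> P i j}
      = card (SIGMA j:{1..n}. {i \<in> {1..<j - 1}. P i j})"
    by (simp add: card_image inj_on_def split: prod.splits)
  also have "\<dots> = (\<Sum>j\<in>{1..n}. card {i \<in> {1..<j - 1}. P i j})"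
    by (rule card_SigmaI) auto
  finally show ?thesis
    by (simp add: Int_def)
qed

text \<open>For distinct \<open>a\<close>, \<open>b\<close>, \<open>c\<close> the three vincular patterns say that \<open>c\<close> is passed
  when walking cyclically upwards from \<open>a\<close> to \<open>b\<close>; this makes the pattern count telescope.\<close>

lemma vincular_count_telescopes:
  fixes a b c :: nat
  assumes "a \<noteq> b" "a \<noteq> c" "b \<noteq> c"
  shows "of_bool (b < a \<and> a < c) + of_bool (a < c \<and> c < b) + of_bool (c < b \<and> b < a)
     = (of_bool (b < a) + of_bool (c < b) - of_bool (c < a) :: int)"
  using assms by (auto simp: of_bool_def)

lemma descent_set_sum:
  "sum f (descent_set n \<pi>) = (\<Sum>i\<in>{1..<n}. of_bool (\<pi> (i + 1) < \<pi> i) * f i)"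
  for f :: "nat \<Rightarrow> int"
proof -
  have "descent_set n \<pi> = {i \<in> {1..<n}. \<pi> (i + 1) < \<pi> i}"
    by (auto simp: descent_set_def)
  then show ?thesis
    by (simp only: sum.inter_filter[OF finite_atLeastLessThan] of_bool_def) (intro sum.cong refl, auto)
qed

lemma des_sum: "int (des n \<pi>) = (\<Sum>i\<in>{1..<n}. of_bool (\<pi> (i + 1) < \<pi> i))"
  using descent_set_sum[of "\<lambda>_. 1" n \<pi>] by (simp add: des_def)

lemma MAJ_sum: "int (MAJ n \<pi>) = (\<Sum>i\<in>{1..<n}. of_bool (\<pi> (i + 1) < \<pi> i) * int i)"
  using descent_set_sum[of int n \<pi>] by (simp add: MAJ_def)

lemma card_permutes_Collect:
  assumes "\<pi> permutes A"
  shows "card {i \<in> A. P (\<pi> i)} = card {v \<in> A. P v}"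
proof -
  have "\<pi> ` {i \<in> A. P (\<pi> i)} = {v \<in> \<pi> ` A. P v}" by blast
  then show ?thesis
    using card_image[OF permutes_inj_on[OF assms], of "{i \<in> A. P (\<pi> i)}"]
    by (simp add: permutes_image[OF assms])
qed

lemma card_permutes_less:
  assumes "\<pi> permutes {1..n}" "k \<in> {1..n}"
  shows "card {i \<in> {1..n}. \<pi> i < k} = k - 1"
proof -
  have "{v \<in> {1..n}. v < k} = {1..<k}" using assms(2) by auto
  then show ?thesis using card_permutes_Collect[OF assms(1), of "\<lambda>v. v < k"] by simp
qed

text \<open>For fixed \<open>j\<close> the three patterns together telescope to the number of
  descents before \<open>j\<close>, minus one if the letter at \<open>j\<close> is smaller than the
  first letter. Summed over \<open>j\<close>, the corrections contribute the number of letters below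
  \<open>\<pi> 1\<close>, and a descent at \<open>i\<close> is counted \<open>n - i\<close> times;
  the extra \<open>des\<close> in \<open>STAT\<close> raises this to
  \<open>n + 1 - i\<close>.\<close>

lemma STAT_eq:
  assumes \<pi>: "\<pi> permutes {1..n}" and "n \<ge> 1"
  shows "int (STAT n \<pi>) = (int n + 1) * int (des n \<pi>) - (int (\<pi> 1) - 1) - int (MAJ n \<pi>)"
proof -
  define d :: "nat \<Rightarrow> int" where "d i = of_bool (\<pi> (i + 1) < \<pi> i)" for i
  have eq: "\<pi> i = \<pi> j \<longleftrightarrow> i = j" for i j
    using permutes_inj[OF \<pi>] by (simp add: inj_eq)
  have passes: "(\<Sum>i\<in>{1..<j - 1}. of_bool (\<pi> (i + 1) < \<pi> i \<and> \<pi> i < \<pi> j))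
      + (\<Sum>i\<in>{1..<j - 1}. of_bool (\<pi> i < \<pi> j \<and> \<pi> j < \<pi> (i + 1)))
      + (\<Sum>i\<in>{1..<j - 1}. of_bool (\<pi> j < \<pi> (i + 1) \<and> \<pi> (i + 1) < \<pi> i))
      = (\<Sum>i\<in>{1..<j}. d i) - of_bool (\<pi> j < \<pi> 1)" (is "?L = _") if "j \<in> {1..n}" for j
  proof (cases "j = 1")
    case False
    define m where "m = j - 1"
    have m: "j = m + 1" "m \<ge> 1" using that False by (auto simp: m_def)
    have "?L = (\<Sum>i\<in>{1..<m}. d i + (of_bool (\<pi> j < \<pi> (Suc i)) - of_bool (\<pi> j < \<pi> i)))"
      unfolding sum.distrib[symmetric] m_def[symmetric]
    proof (intro sum.cong refl)
      fix i assume "i \<in> {1..<m}"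
      then show "of_bool (\<pi> (i + 1) < \<pi> i \<and> \<pi> i < \<pi> j) + of_bool (\<pi> i < \<pi> j \<and> \<pi> j < \<pi> (i + 1))
          + of_bool (\<pi> j < \<pi> (i + 1) \<and> \<pi> (i + 1) < \<pi> i)
          = d i + (of_bool (\<pi> j < \<pi> (Suc i)) - of_bool (\<pi> j < \<pi> i))"
        using vincular_count_telescopes[of "\<pi> i" "\<pi> (i + 1)" "\<pi> j"] by (auto simp: eq d_def m)
    qed
    \<comment> \<open>The patterns only see \<open>i < j - 1\<close>. The upper boundary term of the
      telescoping sum compares the letters at \<open>m\<close> and \<open>j = m + 1\<close>, so it
      is \<open>d m\<close> and supplies the missing index \<open>j - 1\<close>.\<close>
    also have "\<dots> = (\<Sum>i\<in>{1..<m}. d i) + (d m - of_bool (\<pi> j < \<pi> 1))"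
      unfolding sum.distrib using m by (subst sum_Suc_diff') (auto simp: d_def)
    finally show ?thesis using m by simp
  qed auto
  have "int (STAT n \<pi>) = int (des n \<pi>) + (\<Sum>j\<in>{1..n}. (\<Sum>i\<in>{1..<j}. d i) - of_bool (\<pi> j < \<pi> 1))"
    unfolding STAT_def of_nat_add card_pairs_sum add.assoc sum.distrib[symmetric]
    by (rule arg_cong[where f = "(+) (int (des n \<pi>))"], rule sum.cong[OF refl],
        subst passes[symmetric], assumption, simp only: sum.distrib add.assoc)
  also have "(\<Sum>j\<in>{1..n}. (\<Sum>i\<in>{1..<j}. d i) - of_bool (\<pi> j < \<pi> 1))
      = (\<Sum>j\<in>{1..n}. \<Sum>i\<in>{1..<j}. d i) - int (card {j \<in> {1..n}. \<pi> j < \<pi> 1})"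
    by (simp add: sum_subtractf Int_def)
  also have "(\<Sum>j\<in>{1..n}. \<Sum>i\<in>{1..<j}. d i) = (\<Sum>i\<in>{1..<n}. \<Sum>j\<in>{i + 1..n}. d i)"
    by (subst sum.Sigma, simp, simp, subst sum.Sigma, simp, simp,
        rule sum.reindex_bij_witness[where i = prod.swap and j = prod.swap]) auto
  also have "\<dots> = (\<Sum>i\<in>{1..<n}. int n * d i - d i * int i)"
    by (intro sum.cong refl) (auto simp: algebra_simps)
  also have "\<dots> = int n * int (des n \<pi>) - int (MAJ n \<pi>)"
    by (simp add: sum_subtractf des_sum MAJ_sum d_def sum_distrib_left)
  finally show ?thesis
    using card_permutes_less[OF \<pi>, of "\<pi> 1"] permutes_in_image[OF \<pi>, of 1] \<open>n \<ge> 1\<close>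
    by (auto simp: algebra_simps)
qed

section \<open>Standardization\<close>

definition standardization :: "nat \<Rightarrow> (nat \<Rightarrow> nat) \<Rightarrow> nat \<Rightarrow> nat" where
  "standardization n w i = (if i \<in> {1..n}
     then card {j \<in> {1..n}. w j < w i \<or> (w j = w i \<and> j \<le> i)} else i)"

lemma standardization_cong:
  assumes "\<And>i. i \<in> {1..n} \<Longrightarrow> w i = w' i"
  shows "standardization n w = standardization n w'"
proof
  fix i
  show "standardization n w i = standardization n w' i"
  proof (cases "i \<in> {1..n}")
    case True
    then have "{j \<in> {1..n}. w j < w i \<or> (w j = w i \<and> j \<le> i)}
        = {j \<in> {1..n}. w' j < w' i \<or> (w' j = w' i \<and> j \<le> i)}"
      by (intro Collect_cong conj_cong refl) (simp only: assms)
    then show ?thesis by (simp add: standardization_def)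
  next
    case False
    then show ?thesis unfolding standardization_def by (simp only: if_False)
  qed
qed

lemma standardization_less:
  assumes "i \<in> {1..n}" "j \<in> {1..n}" "w i < w j \<or> (w i = w j \<and> i < j)"
  shows "standardization n w i < standardization n w j"
proof -
  have "{l \<in> {1..n}. w l < w i \<or> (w l = w i \<and> l \<le> i)} \<subset> {l \<in> {1..n}. w l < w j \<or> (w l = w j \<and> l \<le> j)}"
    using assms by (auto intro: less_trans)
  then have "card {l \<in> {1..n}. w l < w i \<or> (w l = w i \<and> l \<le> i)}
      < card {l \<in> {1..n}. w l < w j \<or> (w l = w j \<and> l \<le> j)}"
    by (intro psubset_card_mono) auto
  then show ?thesis using assms by (simp add: standardization_def)
qed

lemma standardization_permutes: "standardization n w permutes {1..n}"
proof (rule bij_imp_permutes)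
  have "inj_on (standardization n w) {1..n}"
  proof (rule inj_onI, rule ccontr)
    fix i j assume ij: "i \<in> {1..n}" "j \<in> {1..n}" "standardization n w i = standardization n w j" "i \<noteq> j"
    then have "(w i < w j \<or> (w i = w j \<and> i < j)) \<or> (w j < w i \<or> (w j = w i \<and> j < i))" by linarith
    then show False using standardization_less[of i n j w] standardization_less[of j n i w] ij by auto
  qed
  moreover have "standardization n w ` {1..n} \<subseteq> {1..n}"
  proof
    fix v assume "v \<in> standardization n w ` {1..n}"
    then obtain i where i: "i \<in> {1..n}" "v = card {j \<in> {1..n}. w j < w i \<or> (w j = w i \<and> j \<le> i)}"
      by (auto simp: standardization_def)
    have "card {j \<in> {1..n}. w j < w i \<or> (w j = w i \<and> j \<le> i)} \<le> card {1..n}"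
      by (intro card_mono) auto
    then have "v \<le> card {1..n}" using i by simp
    moreover have "v \<noteq> 0" using i by auto
    ultimately show "v \<in> {1..n}" by simp
  qed
  ultimately show "bij_betw (standardization n w) {1..n} {1..n}"
    using endo_inj_surj[of "{1..n}"] by (auto simp: bij_betw_def)
qed (auto simp: standardization_def)

text \<open>The word \<open>c \<circ> \<sigma>\<close> is a rearrangement of the weakly increasing
  word \<open>c 1, ..., c n\<close>, so the letter of rank \<open>s\<close> must be
  \<open>c s\<close>. If \<open>c s\<close> were too small, all of \<open>1, ..., s\<close> would
  have labels below \<open>c (\<sigma> i)\<close>, making the rank exceed \<open>s\<close>; if it
  were too large, fewer than \<open>s\<close> letters would be available.\<close>

lemma standardization_label:
  assumes c: "mono c" and \<sigma>: "\<sigma> permutes {1..n}" and i: "i \<in> {1..n}"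
  shows "c (standardization n (c \<circ> \<sigma>) i) = c (\<sigma> i)"
proof -
  let ?s = "standardization n (c \<circ> \<sigma>) i"
  note count = card_permutes_Collect[OF \<sigma>]
  have s: "?s \<in> {1..n}" using permutes_in_image[OF standardization_permutes] i by blast
  have "\<not> c ?s < c (\<sigma> i)"
  proof
    assume less: "c ?s < c (\<sigma> i)"
    have "{1..?s} \<subseteq> {v \<in> {1..n}. c v < c (\<sigma> i)}"
      using s less by (auto intro: le_less_trans[OF monoD[OF c]])
    then have "card {1..?s} \<le> card {v \<in> {1..n}. c v < c (\<sigma> i)}" by (intro card_mono) auto
    also have "\<dots> = card {j \<in> {1..n}. c (\<sigma> j) < c (\<sigma> i)}" by (rule count[symmetric])
    also have "\<dots> < card {j \<in> {1..n}. c (\<sigma> j) < c (\<sigma> i) \<or> (c (\<sigma> j) = c (\<sigma> i) \<and> j \<le> i)}"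
      by (rule psubset_card_mono, simp, rule psubsetI, blast, use i in blast)
    also have "\<dots> = ?s" using i by (simp add: standardization_def)
    finally show False by simp
  qed
  moreover have "\<not> c (\<sigma> i) < c ?s"
  proof
    assume less: "c (\<sigma> i) < c ?s"
    have "?s = card {j \<in> {1..n}. c (\<sigma> j) < c (\<sigma> i) \<or> (c (\<sigma> j) = c (\<sigma> i) \<and> j \<le> i)}"
      using i by (simp add: standardization_def)
    also have "\<dots> \<le> card {j \<in> {1..n}. c (\<sigma> j) \<le> c (\<sigma> i)}" by (intro card_mono) auto
    also have "\<dots> = card {v \<in> {1..n}. c v \<le> c (\<sigma> i)}" by (rule count)
    also have "\<dots> \<le> card {1..<?s}"
    proof (intro card_mono subsetI)
      fix v assume v: "v \<in> {v \<in> {1..n}. c v \<le> c (\<sigma> i)}"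
      have "\<not> ?s \<le> v" using monoD[OF c, of ?s v] v less by auto
      then show "v \<in> {1..<?s}" using v by auto
    qed auto
    finally have "?s \<le> ?s - 1" by (simp only: card_atLeastLessThan)
    then show False using s unfolding atLeastAtMost_iff by linarith
  qed
  ultimately show ?thesis by simp
qed

text \<open>Ordering positions by label, with ties broken from left to right, is the same as
  ordering them by \<open>\<omega>\<close> once \<open>\<omega>\<close> increases on each set of
  equal labels. Such an \<open>\<omega>\<close> can therefore be recovered from its word of
  labels.\<close>

lemma standardization_eq:
  assumes c: "mono c" and \<omega>: "\<omega> permutes {1..n}"
    and sorted: "\<And>i j. \<lbrakk>i \<in> {1..n}; j \<in> {1..n}; i < j; c (\<omega> i) = c (\<omega> j)\<rbrakk> \<Longrightarrow> \<omega> i < \<omega> j"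
  shows "standardization n (c \<circ> \<omega>) = \<omega>"
proof
  fix i
  show "standardization n (c \<circ> \<omega>) i = \<omega> i"
  proof (cases "i \<in> {1..n}")
    case True
    have iff: "c (\<omega> j) < c (\<omega> i) \<or> (c (\<omega> j) = c (\<omega> i) \<and> j \<le> i) \<longleftrightarrow> \<omega> j \<le> \<omega> i"
      if "j \<in> {1..n}" for j
    proof (cases "i = j")
      case False
      have "j < i \<longrightarrow> c (\<omega> j) = c (\<omega> i) \<longrightarrow> \<omega> j < \<omega> i" "i < j \<longrightarrow> c (\<omega> i) = c (\<omega> j) \<longrightarrow> \<omega> i < \<omega> j"
        "\<omega> i \<le> \<omega> j \<longrightarrow> c (\<omega> i) \<le> c (\<omega> j)" "\<omega> j \<le> \<omega> i \<longrightarrow> c (\<omega> j) \<le> c (\<omega> i)"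
        using sorted[OF that True] sorted[OF True that] monoD[OF c] by blast+
      then show ?thesis using False by linarith
    qed simp
    have "\<omega> i \<in> {1..n}" using True permutes_in_image[OF \<omega>] by blast
    then have "{v \<in> {1..n}. v \<le> \<omega> i} = {1..\<omega> i}" by auto
    then have "card {j \<in> {1..n}. \<omega> j \<le> \<omega> i} = \<omega> i"
      using card_permutes_Collect[OF \<omega>, of "\<lambda>v. v \<le> \<omega> i"] by simp
    moreover have "{j \<in> {1..n}. c (\<omega> j) < c (\<omega> i) \<or> (c (\<omega> j) = c (\<omega> i) \<and> j \<le> i)}
        = {j \<in> {1..n}. \<omega> j \<le> \<omega> i}" using iff by blast
    ultimately show ?thesis using True by (simp add: standardization_def)
  qed (use \<omega> in \<open>auto simp: standardization_def permutes_def\<close>)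
qed

section \<open>Blocks of letters and inverse descent sets\<close>

definition label :: "nat set \<Rightarrow> nat \<Rightarrow> nat" where
  "label B v = card {x \<in> B. x < v}"

text \<open>A cut point \<open>x\<close> separates \<open>x\<close> from \<open>x + 1\<close>, just
  as a descent at \<open>x\<close> does. The same blocks serve for letters and for
  positions.\<close>

definition same_block :: "nat set \<Rightarrow> nat \<Rightarrow> nat \<Rightarrow> bool" where
  "same_block B u v \<longleftrightarrow> (\<forall>x\<in>B. x < u \<longleftrightarrow> x < v)"

lemma mono_label: "mono (label B)"
  unfolding label_def by (intro monoI card_mono) auto

text \<open>The sets of cut points below \<open>u\<close> and below \<open>v\<close> are nested, so
  equal cardinality already forces them to coincide.\<close>

lemma label_eq_iff: "label B u = label B v \<longleftrightarrow> same_block B u v"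
proof
  assume eq: "label B u = label B v"
  have "{x \<in> B. x < u} \<subseteq> {x \<in> B. x < v} \<or> {x \<in> B. x < v} \<subseteq> {x \<in> B. x < u}"
    by (cases u v rule: linorder_cases) auto
  then have "{x \<in> B. x < u} = {x \<in> B. x < v}"
  proof
    assume "{x \<in> B. x < u} \<subseteq> {x \<in> B. x < v}"
    then show ?thesis using eq unfolding label_def by (rule card_subset_eq[rotated]) simp
  next
    assume "{x \<in> B. x < v} \<subseteq> {x \<in> B. x < u}"
    then show ?thesis using eq[symmetric] unfolding label_def by (intro card_subset_eq[symmetric]) simp_all
  qed
  then show "same_block B u v" unfolding same_block_def by blast
next
  assume "same_block B u v"
  then have "{x \<in> B. x < u} = {x \<in> B. x < v}" unfolding same_block_def by blast
  then show "label B u = label B v" by (simp add: label_def)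
qed

text \<open>If \<open>v\<close> is not a cut, then \<open>v\<close> and \<open>v + 1\<close> share a
  label, and \<open>v\<close> fails to be an inverse descent exactly when they occur in increasing
  order. With \<open>standardization_eq\<close> this turns permutations with inverse descents in
  \<open>B\<close> into words in the labels.\<close>

lemma inverse_descent_set_subset_iff:
  assumes \<omega>: "\<omega> permutes {1..n}"
  shows "inverse_descent_set n \<omega> \<subseteq> B \<longleftrightarrow>
    (\<forall>i\<in>{1..n}. \<forall>j\<in>{1..n}. i < j \<longrightarrow> label B (\<omega> i) = label B (\<omega> j) \<longrightarrow> \<omega> i < \<omega> j)" (is "?L \<longleftrightarrow> ?R")
proof
  assume L: ?L
  \<comment> \<open>Only neighbouring letters are controlled directly; induction on the larger
    letter chains them through the block, none of whose interior letters \<open>v - 1\<close> is a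
    cut.\<close>
  have inc: "inv \<omega> u < inv \<omega> v" if "u < v" "1 \<le> u" "v \<le> n" "same_block B u v" for u v
    using that
  proof (induction v rule: less_induct)
    case (less v)
    define v' where "v' = v - 1"
    have v: "v = v' + 1" "u \<le> v'" using less.prems by (auto simp: v'_def)
    have "v' \<notin> B" using less.prems(4) v by (auto simp: same_block_def)
    then have "v' \<notin> inverse_descent_set n \<omega>" using L by blast
    then have "\<not> inv \<omega> v < inv \<omega> v'" using v less.prems by (simp add: inverse_descent_set_def)
    moreover have "inv \<omega> v \<noteq> inv \<omega> v'"
      using v permutes_inj[OF permutes_inv[OF \<omega>]] by (auto simp: inj_eq)
    ultimately have "inv \<omega> v' < inv \<omega> v" by simp
    moreover have "inv \<omega> u \<le> inv \<omega> v'"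
    proof (cases "u = v'")
      case False
      have "same_block B u v'"
        using less.prems(4) v False \<open>v' \<notin> B\<close> unfolding same_block_def by (metis less_Suc_eq Suc_eq_plus1)
      then show ?thesis using less.IH[of v'] v less.prems False by simp
    qed simp
    ultimately show ?case by simp
  qed
  show ?R
  proof (intro ballI impI)
    fix i j assume ij: "i \<in> {1..n}" "j \<in> {1..n}" "i < j" "label B (\<omega> i) = label B (\<omega> j)"
    have "\<omega> i \<in> {1..n}" "\<omega> j \<in> {1..n}" using ij permutes_in_image[OF \<omega>] by blast+
    moreover have "\<omega> i \<noteq> \<omega> j" using ij permutes_inj[OF \<omega>] by (auto simp: inj_eq)
    moreover have "\<not> \<omega> j < \<omega> i"
    proof
      assume "\<omega> j < \<omega> i"
      moreover have "same_block B (\<omega> j) (\<omega> i)" using ij by (simp add: label_eq_iff[symmetric])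
      ultimately have "inv \<omega> (\<omega> j) < inv \<omega> (\<omega> i)"
        using inc \<open>\<omega> i \<in> {1..n}\<close> \<open>\<omega> j \<in> {1..n}\<close> by simp
      then show False using ij by (simp add: permutes_inverses[OF \<omega>])
    qed
    ultimately show "\<omega> i < \<omega> j" by simp
  qed
next
  assume R: ?R
  show ?L
  proof (rule subsetI, rule ccontr)
    fix v assume v: "v \<in> inverse_descent_set n \<omega>" "v \<notin> B"
    then have "same_block B (v + 1) v" by (auto simp: same_block_def less_Suc_eq)
    then have "label B (v + 1) = label B v" by (simp add: label_eq_iff)
    moreover have "inv \<omega> (v + 1) \<in> {1..n}" "inv \<omega> v \<in> {1..n}" "inv \<omega> (v + 1) < inv \<omega> v"
      unfolding permutes_in_image[OF permutes_inv[OF \<omega>]]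
      using v by (auto simp: inverse_descent_set_def)
    ultimately have "\<omega> (inv \<omega> (v + 1)) < \<omega> (inv \<omega> v)"
      using R[rule_format, of "inv \<omega> (v + 1)" "inv \<omega> v"] by (simp only: permutes_inverses[OF \<omega>])
    then show False by (simp add: permutes_inverses[OF \<omega>])
  qed
qed

section \<open>Reversal inside blocks\<close>

text \<open>The block of \<open>i\<close> runs from \<open>block_lo A i + 1\<close> to
  \<open>block_hi n A i\<close>. The artificial cuts 0 and \<open>n\<close> close off the two outer
  blocks.\<close>

definition block_lo :: "nat set \<Rightarrow> nat \<Rightarrow> nat" where
  "block_lo A i = (GREATEST a. a < i \<and> a \<in> insert 0 A)"

definition block_hi :: "nat \<Rightarrow> nat set \<Rightarrow> nat \<Rightarrow> nat" where
  "block_hi n A i = (LEAST a. i \<le> a \<and> a \<in> insert n A)"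

text \<open>The cut points \<open>A\<close> split \<open>{1..n}\<close> into intervals, each ending at a cut point or at \<open>n\<close>;
  every interval is reversed.\<close>

definition block_rev :: "nat \<Rightarrow> nat set \<Rightarrow> nat \<Rightarrow> nat" where
  "block_rev n A i = (if i \<in> {1..n} then block_lo A i + block_hi n A i + 1 - i else i)"

lemma block_bounds:
  assumes "A \<subseteq> {1..<n}" "i \<in> {1..n}"
  shows "block_lo A i < i" "block_lo A i \<in> insert 0 A"
    "i \<le> block_hi n A i" "block_hi n A i \<in> insert n A" "block_hi n A i \<le> n"
    and "\<And>a. \<lbrakk>a \<in> A; block_lo A i < a\<rbrakk> \<Longrightarrow> block_hi n A i \<le> a"
proof -
  have lo: "block_lo A i < i \<and> block_lo A i \<in> insert 0 A"
    unfolding block_lo_def by (rule GreatestI_nat[of _ 0 i]) (use assms in auto)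
  have hi: "i \<le> block_hi n A i \<and> block_hi n A i \<in> insert n A"
    unfolding block_hi_def by (rule LeastI[of _ n]) (use assms in auto)
  show "block_lo A i < i" "block_lo A i \<in> insert 0 A" "i \<le> block_hi n A i"
    "block_hi n A i \<in> insert n A" using lo hi by auto
  show "block_hi n A i \<le> n" using hi assms(1) by auto
  fix a assume a: "a \<in> A" "block_lo A i < a"
  have "\<not> a < i"
  proof
    assume "a < i"
    then have "a \<le> block_lo A i"
      unfolding block_lo_def by (intro Greatest_le_nat[of _ _ i]) (use a in auto)
    then show False using a by simp
  qed
  then show "block_hi n A i \<le> a"
    unfolding block_hi_def by (intro Least_le) (use a in auto)
qed

lemma same_block_bounds_eq:
  assumes "same_block A i j" "i \<in> {1..n}" "j \<in> {1..n}"
  shows "block_lo A i = block_lo A j" "block_hi n A i = block_hi n A j"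
proof -
  have "(\<lambda>a. i \<le> a \<and> a \<in> insert n A) = (\<lambda>a. j \<le> a \<and> a \<in> insert n A)"
    using assms by (auto simp: same_block_def fun_eq_iff not_less[symmetric])
  then show "block_hi n A i = block_hi n A j" by (simp add: block_hi_def)
  have "(\<lambda>a. a < i \<and> a \<in> insert 0 A) = (\<lambda>a. a < j \<and> a \<in> insert 0 A)"
    using assms by (auto simp: same_block_def fun_eq_iff)
  then show "block_lo A i = block_lo A j" by (simp add: block_lo_def)
qed

lemma block_cong:
  assumes "A \<subseteq> {1..<n}" "i \<in> {1..n}" "block_lo A i < j" "j \<le> block_hi n A i"
  shows "j \<in> {1..n}" "same_block A j i" "block_lo A j = block_lo A i" "block_hi n A j = block_hi n A i"
proof -
  note b = block_bounds[OF assms(1,2)]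
  show j: "j \<in> {1..n}" using assms(3,4) b by auto
  show sb: "same_block A j i"
    unfolding same_block_def
  proof
    fix x assume "x \<in> A"
    then have "x \<le> block_lo A i \<or> block_hi n A i \<le> x" using b(6)[of x] by linarith
    then show "(x < j) = (x < i)" using b(1,3) assms(3,4) by linarith
  qed
  show "block_lo A j = block_lo A i" "block_hi n A j = block_hi n A i"
    using same_block_bounds_eq[OF sb j assms(2)] by simp_all
qed

context
  fixes n :: nat and A :: "nat set"
  assumes A: "A \<subseteq> {1..<n}"
begin

lemma block_rev_range:
  assumes "i \<in> {1..n}"
  shows "block_lo A i < block_rev n A i" "block_rev n A i \<le> block_hi n A i"
  using block_bounds[OF A assms] assms by (auto simp: block_rev_def)

lemma block_rev_in: "i \<in> {1..n} \<Longrightarrow> block_rev n A i \<in> {1..n}"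
  using block_cong(1)[OF A _ block_rev_range] .

lemma block_rev_less:
  assumes "i \<in> {1..n}" "j \<in> {1..n}" "same_block A i j" "i < j"
  shows "block_rev n A j < block_rev n A i"
  using same_block_bounds_eq[OF assms(3,1,2)] block_bounds[OF A assms(1)] block_bounds[OF A assms(2)] assms
  by (simp add: block_rev_def)

lemma same_block_block_rev: "same_block A (block_rev n A i) i"
  using block_cong(2)[OF A _ block_rev_range] by (cases "i \<in> {1..n}") (auto simp: block_rev_def same_block_def)

lemma block_rev_involution: "block_rev n A (block_rev n A i) = i"
proof (cases "i \<in> {1..n}")
  case True
  show ?thesis
    using block_rev_in[OF True] block_cong(3,4)[OF A True block_rev_range[OF True]]
      block_bounds[OF A True] True
    by (simp add: block_rev_def)
qed (auto simp: block_rev_def)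

lemma block_rev_permutes: "block_rev n A permutes {1..n}"
proof (rule bij_imp_permutes)
  show "bij_betw (block_rev n A) {1..n} {1..n}"
    by (rule bij_betw_byWitness[where f' = "block_rev n A"])
      (use block_rev_in in \<open>auto simp: block_rev_involution simp del: atLeastAtMost_iff\<close>)
qed (auto simp: block_rev_def)

text \<open>If \<open>i\<close> is not a cut, then \<open>i\<close> and \<open>i + 1\<close> lie in
  one block, so their images are again adjacent, in the opposite order. The smaller image is
  followed by a member of its own block and hence is no cut either.\<close>

lemma block_rev_Suc:
  assumes "i \<in> {1..<n}" "i \<notin> A"
  shows "block_rev n A i = block_rev n A (i + 1) + 1" "block_rev n A (i + 1) \<notin> A"
proof -
  have i: "i \<in> {1..n}" "i + 1 \<in> {1..n}" using assms by auto
  note b = block_bounds[OF A i(1)]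
  have "block_hi n A i \<noteq> i" using b(4) assms by auto
  then have "i + 1 \<le> block_hi n A i" "block_lo A i < i + 1" using b by auto
  note c = block_cong(3,4)[OF A i(1) this(2,1)]
  show eq: "block_rev n A i = block_rev n A (i + 1) + 1"
    using c i \<open>i + 1 \<le> block_hi n A i\<close> by (simp add: block_rev_def)
  show "block_rev n A (i + 1) \<notin> A"
    using block_rev_range[OF i(1)] block_rev_range[OF i(2)] b(6)[of "block_rev n A (i + 1)"] eq c by auto
qed

end

section \<open>Reflecting the descent set within a Young subgroup\<close>

text \<open>This is inclusion-exclusion without the explicit signs: by induction the terms of all
  proper subsets cancel.\<close>

lemma subset_sums_eqD:
  fixes f g :: "'a set \<Rightarrow> nat"
  assumes "finite U" and eq: "\<And>A. A \<subseteq> U \<Longrightarrow> (\<Sum>X\<in>Pow A. f X) = (\<Sum>X\<in>Pow A. g X)" and "A \<subseteq> U"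
  shows "f A = g A"
proof -
  have "finite A" using assms by (auto intro: finite_subset)
  then show ?thesis using \<open>A \<subseteq> U\<close>
  proof (induction A rule: finite_psubset_induct)
    case (psubset A)
    have "(\<Sum>X\<in>Pow A - {A}. f X) = (\<Sum>X\<in>Pow A - {A}. g X)"
      by (intro sum.cong refl psubset.IH) (use psubset.prems in auto)
    then show ?case
      using eq[OF psubset.prems] psubset.hyps by (simp add: sum.remove[of "Pow A" A])
  qed
qed

lemma card_subset_fibres:
  assumes "finite X" "finite A"
  shows "card {x \<in> X. F x \<subseteq> A \<and> Q x} = (\<Sum>Z\<in>Pow A. card {x \<in> X. F x = Z \<and> Q x})"
proof -
  have "{x \<in> X. F x \<subseteq> A \<and> Q x} = (\<Union>Z\<in>Pow A. {x \<in> X. F x = Z \<and> Q x})" by auto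
  then show ?thesis
    using assms by (simp only:) (intro card_UN_disjoint, auto)
qed

text \<open>Bijections between corresponding fibres are glued together. This converts an equality of
  counts into a map, so no explicit bijection has to be constructed.\<close>

lemma bij_betw_of_equal_fibres:
  assumes "finite X" and eq: "\<And>t. card {x \<in> X. f x = t} = card {x \<in> X. g x = t}"
  obtains h where "bij_betw h X X" "\<And>x. x \<in> X \<Longrightarrow> g (h x) = f x"
proof -
  have "\<exists>h. bij_betw h {x \<in> X. f x = t} {x \<in> X. g x = t}" for t
    using finite_same_card_bij[OF _ _ eq[of t]] assms(1) by auto
  then obtain H where H: "\<And>t. bij_betw (H t) {x \<in> X. f x = t} {x \<in> X. g x = t}" by metis
  define h where "h x = H (f x) x" for x
  have h: "h x \<in> X" "g (h x) = f x" if "x \<in> X" for x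
    using H[of "f x"] that by (auto simp: bij_betw_def h_def)
  have "inj_on h X"
  proof (rule inj_onI)
    fix x y assume xy: "x \<in> X" "y \<in> X" "h x = h y"
    then have "f x = f y" using h by metis
    then show "x = y" using xy H[of "f x"] by (auto simp: bij_betw_def h_def inj_on_def)
  qed
  moreover have "h ` X \<subseteq> X" using h by auto
  ultimately have "bij_betw h X X"
    using endo_inj_surj[OF assms(1)] by (auto simp: bij_betw_def)
  then show thesis using that h by blast
qed

text \<open>For \<open>K \<subseteq> {1..<n}\<close> this is the Young subgroup of the permutations
  that map each interval between consecutive cuts to itself.\<close>

definition young :: "nat \<Rightarrow> nat set \<Rightarrow> (nat \<Rightarrow> nat) set" where
  "young n K = {\<omega>. \<omega> permutes {1..n} \<and> (\<forall>i\<in>{1..n}. same_block K (\<omega> i) i)}"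

text \<open>This acts on descent positions, that is, on adjacent pairs. Reversal sends the pair
  \<open>i\<close>, \<open>i + 1\<close> to a pair whose left member is the image of
  \<open>i + 1\<close>, not that of \<open>i\<close>.\<close>

definition flip :: "nat \<Rightarrow> nat set \<Rightarrow> nat \<Rightarrow> nat" where
  "flip n K i = block_rev n K (i + 1)"

lemma same_block_trans: "same_block K i j \<Longrightarrow> same_block K j l \<Longrightarrow> same_block K i l"
  by (simp add: label_eq_iff[symmetric])

lemma same_block_sym: "same_block K i j \<Longrightarrow> same_block K j i"
  by (simp add: label_eq_iff[symmetric])

context
  fixes n :: nat and K :: "nat set"
  assumes K: "K \<subseteq> {1..<n}"
begin

lemma flip_range:
  assumes "i \<in> {1..<n} - K"
  shows "flip n K i \<in> {1..<n} - K" "block_rev n K i = flip n K i + 1"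
proof -
  show eq: "block_rev n K i = flip n K i + 1"
    using block_rev_Suc(1)[OF K] assms by (auto simp: flip_def)
  show "flip n K i \<in> {1..<n} - K"
    using block_rev_Suc(2)[OF K, of i] block_rev_in[OF K, of "i + 1"] block_rev_in[OF K, of i] assms eq
    by (auto simp: flip_def)
qed

lemma flip_involution:
  assumes "i \<in> {1..<n} - K"
  shows "flip n K (flip n K i) = i"
  using flip_range[OF assms] block_rev_involution[OF K, of i] by (simp add: flip_def)

lemma finite_young: "finite (young n K)"
  by (rule finite_subset[OF _ finite_permutations[of "{1..n}"]]) (auto simp: young_def)

text \<open>At a cut \<open>i\<close> the letter in position \<open>i\<close> is at most
  \<open>i\<close>, while the next letter exceeds \<open>i\<close>, so there is an ascent.\<close>

lemma young_descent_set:
  assumes "\<omega> \<in> young n K"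
  shows "descent_set n \<omega> \<subseteq> {1..<n} - K"
proof
  fix i assume i: "i \<in> descent_set n \<omega>"
  then have ir: "i \<in> {1..n}" "i + 1 \<in> {1..n}" "\<omega> (i + 1) < \<omega> i" by (auto simp: descent_set_def)
  then have "same_block K (\<omega> i) i" "same_block K (\<omega> (i + 1)) (i + 1)" using assms unfolding young_def by blast+
  then have "i \<notin> K" using ir(3) by (force simp: same_block_def)
  then show "i \<in> {1..<n} - K" using i by (auto simp: descent_set_def)
qed

lemma young_inverse_descent_set:
  assumes "\<omega> \<in> young n K"
  shows "inverse_descent_set n \<omega> \<subseteq> {1..<n} - K"
proof
  fix v assume v: "v \<in> inverse_descent_set n \<omega>"
  have \<omega>: "\<omega> permutes {1..n}" using assms by (simp add: young_def)
  define i j where "i = inv \<omega> v" and "j = inv \<omega> (v + 1)"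
  have ij: "\<omega> i = v" "\<omega> j = v + 1" by (simp_all add: i_def j_def permutes_inverses[OF \<omega>])
  have "v \<in> {1..n}" "v + 1 \<in> {1..n}" using v by (auto simp: inverse_descent_set_def)
  then have "i \<in> {1..n}" "j \<in> {1..n}" using ij permutes_in_image[OF \<omega>] by metis+
  then have "same_block K v i" "same_block K (v + 1) j" using assms ij unfolding young_def by (metis (no_types, lifting) mem_Collect_eq)+
  moreover have "j < i" using v by (auto simp: inverse_descent_set_def i_def j_def)
  ultimately have "v \<notin> K" by (force simp: same_block_def)
  then show "v \<in> {1..<n} - K" using v by (auto simp: inverse_descent_set_def)
qed

text \<open>Words labelled by \<open>B \<union> K\<close> are rearranged by reversing the order of their
  \<open>A\<close>-runs inside every block of \<open>K\<close>, and standardized again.\<close>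

lemma card_young_le:
  assumes A: "A \<subseteq> {1..<n} - K"
  shows "card {\<omega> \<in> young n K. descent_set n \<omega> \<subseteq> A \<and> inverse_descent_set n \<omega> \<subseteq> B}
    \<le> card {\<omega> \<in> young n K. flip n K ` descent_set n \<omega> \<subseteq> A \<and> inverse_descent_set n \<omega> \<subseteq> B}"
    (is "card ?X \<le> card ?Y")
proof -
  define c where "c = label (B \<union> K)"
  \<comment> \<open>Reversing each \<open>K\<close>-block and then each run cut out by
    \<open>A \<union> K\<close> makes \<open>\<omega> \<circ> p\<close> list the runs of a
    \<open>K\<close>-block in reverse order, each run still read from left to right.\<close>
  define p where "p = block_rev n (A \<union> K) \<circ> block_rev n K"
  define \<Phi> where "\<Phi> \<omega> = standardization n (c \<circ> (\<omega> \<circ> p))" for \<omega>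
  have AK: "A \<union> K \<subseteq> {1..<n}" using A K by auto
  have c: "mono c" by (simp add: c_def mono_label)
  have c_block: "same_block K i j" if "c i = c j" for i j
    using that by (auto simp: c_def label_eq_iff same_block_def)
  have p: "p permutes {1..n}"
    unfolding p_def by (intro permutes_compose block_rev_permutes AK K)
  have p_block: "same_block K (p i) i" for i
  proof -
    have "same_block K (p i) (block_rev n K i)"
      using same_block_block_rev[OF AK, of "block_rev n K i"] unfolding p_def same_block_def o_def by blast
    then show ?thesis using same_block_block_rev[OF K] by (rule same_block_trans)
  qed
  have perm: "\<omega> \<circ> p permutes {1..n}" if "\<omega> \<in> young n K" for \<omega>
    using that p by (simp add: young_def permutes_compose)
  have label: "c (\<Phi> \<omega> i) = c (\<omega> (p i))" if "\<omega> \<in> young n K" "i \<in> {1..n}" for \<omega> i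
    using standardization_label[OF c perm that(2)] that(1) by (simp add: \<Phi>_def)
  have young: "\<Phi> \<omega> \<in> young n K" if "\<omega> \<in> young n K" for \<omega>
  proof -
    have "same_block K (\<Phi> \<omega> i) i" if i: "i \<in> {1..n}" for i
    proof -
      have "p i \<in> {1..n}" using i permutes_in_image[OF p] by blast
      then have "same_block K (\<omega> (p i)) (p i)" using \<open>\<omega> \<in> young n K\<close> unfolding young_def by blast
      then show ?thesis
        using c_block[OF label[OF \<open>\<omega> \<in> young n K\<close> i]] p_block[of i] by (blast intro: same_block_trans)
    qed
    moreover have "\<Phi> \<omega> permutes {1..n}" unfolding \<Phi>_def by (rule standardization_permutes)
    ultimately show ?thesis unfolding young_def by blast
  qed
  have sorted: "\<Phi> \<omega> i < \<Phi> \<omega> j"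
    if "\<omega> \<in> young n K" "i \<in> {1..n}" "j \<in> {1..n}" "i < j" "c (\<Phi> \<omega> i) = c (\<Phi> \<omega> j)" for \<omega> i j
    using standardization_less[OF that(2,3), of "c \<circ> (\<omega> \<circ> p)"] that(4,5) label that(1-3) by (simp add: \<Phi>_def)
  have inv_des: "inverse_descent_set n (\<Phi> \<omega>) \<subseteq> B" if "\<omega> \<in> young n K" for \<omega>
  proof -
    have "\<Phi> \<omega> permutes {1..n}" unfolding \<Phi>_def by (rule standardization_permutes)
    \<comment> \<open>The labels only bound the inverse descents by \<open>B \<union> K\<close>; the
      cuts in \<open>K\<close> are then excluded because \<open>\<Phi> \<omega>\<close> lies in the
      Young subgroup.\<close>
    then have "inverse_descent_set n (\<Phi> \<omega>) \<subseteq> B \<union> K"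
      using sorted[OF that] by (subst inverse_descent_set_subset_iff) (auto simp: c_def)
    then show ?thesis using young_inverse_descent_set[OF young[OF that]] by blast
  qed
  have des: "flip n K ` descent_set n (\<Phi> \<omega>) \<subseteq> A" if "\<omega> \<in> ?X" for \<omega>
  proof (rule image_subsetI, rule ccontr)
    fix i assume i: "i \<in> descent_set n (\<Phi> \<omega>)" "flip n K i \<notin> A"
    have \<omega>: "\<omega> \<in> young n K" "descent_set n \<omega> \<subseteq> A" using that by auto
    have iK: "i \<in> {1..<n} - K" using young_descent_set[OF young[OF \<omega>(1)]] i(1) by blast
    define m where "m = flip n K i"
    have m: "m \<in> {1..<n} - (A \<union> K)" "block_rev n K i = m + 1" "block_rev n K (i + 1) = m"
      using flip_range[OF iK] i(2) by (auto simp: m_def flip_def)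
    \<comment> \<open>A position whose flip is outside \<open>A\<close> comes from the interior of a
      run, which \<open>p\<close> traverses forwards. There \<open>\<omega>\<close> ascends, so the
      labels ascend weakly, and a descent of \<open>\<Phi> \<omega>\<close> would need equal labels,
      which standardization numbers increasingly.\<close>
    have pi: "p (i + 1) = p i + 1" "p i \<notin> A \<union> K"
      using block_rev_Suc[OF AK, of m] m by (auto simp: p_def)
    have i': "i \<in> {1..n}" "i + 1 \<in> {1..n}" using iK by auto
    have "p i \<in> {1..n}" "p (i + 1) \<in> {1..n}" using i' permutes_in_image[OF p] by blast+
    then have "p i \<notin> descent_set n \<omega>" "p i \<in> {1..<n}" using pi \<omega>(2) by auto
    then have "\<omega> (p i) \<le> \<omega> (p (i + 1))" using pi by (auto simp: descent_set_def)
    then have "c (\<Phi> \<omega> i) \<le> c (\<Phi> \<omega> (i + 1))"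
      using label[OF \<omega>(1)] i' monoD[OF c] by metis
    moreover have less: "\<Phi> \<omega> (i + 1) < \<Phi> \<omega> i" using i(1) by (simp add: descent_set_def)
    ultimately have "c (\<Phi> \<omega> i) = c (\<Phi> \<omega> (i + 1))" using monoD[OF c, of "\<Phi> \<omega> (i + 1)" "\<Phi> \<omega> i"] by simp
    then show False using sorted[OF \<omega>(1) i'] less by simp
  qed
  have "inj_on \<Phi> ?X"
  proof (rule inj_onI)
    fix \<omega> \<omega>' assume X: "\<omega> \<in> ?X" "\<omega>' \<in> ?X" and eq: "\<Phi> \<omega> = \<Phi> \<omega>'"
    \<comment> \<open>Injectivity: \<open>\<Phi> \<omega>\<close> has the same labels as
      \<open>\<omega> \<circ> p\<close>. Undoing \<open>p\<close> yields the labels of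
      \<open>\<omega>\<close>, and these determine \<open>\<omega>\<close>.\<close>
    have std: "standardization n (c \<circ> \<tau>) = \<tau>" if "\<tau> \<in> ?X" for \<tau>
    proof -
      have \<tau>: "\<tau> permutes {1..n}" "inverse_descent_set n \<tau> \<subseteq> B \<union> K" using that by (auto simp: young_def)
      then show ?thesis
        using inverse_descent_set_subset_iff[OF \<tau>(1)] by (intro standardization_eq c) (auto simp: c_def)
    qed
    have "c (\<omega> i) = c (\<omega>' i)" if "i \<in> {1..n}" for i
    proof -
      have "inv p i \<in> {1..n}" using that permutes_in_image[OF permutes_inv[OF p]] by blast
      then show ?thesis
        using label[of \<omega> "inv p i"] label[of \<omega>' "inv p i"] X eq by (simp add: permutes_inverses[OF p])
    qed
    then have "standardization n (c \<circ> \<omega>) = standardization n (c \<circ> \<omega>')"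
      by (intro standardization_cong) simp
    then show "\<omega> = \<omega>'" using std X by simp
  qed
  moreover have "\<Phi> ` ?X \<subseteq> ?Y"
  proof (rule image_subsetI)
    fix \<omega> assume "\<omega> \<in> ?X"
    then show "\<Phi> \<omega> \<in> ?Y" using young[of \<omega>] inv_des[of \<omega>] des[of \<omega>] by blast
  qed
  ultimately show ?thesis
    by (rule card_inj_on_le) (simp add: finite_young)
qed

text \<open>The reverse inequality is the same bound applied to \<open>flip n K\<close> followed by
  image of \<open>A\<close>: since \<open>flip\<close> is an involution, the two conditions on the
  descent set change places.\<close>

lemma card_young_subset_eq:
  assumes A: "A \<subseteq> {1..<n} - K"
  shows "card {\<omega> \<in> young n K. descent_set n \<omega> \<subseteq> A \<and> inverse_descent_set n \<omega> \<subseteq> B}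
    = card {\<omega> \<in> young n K. flip n K ` descent_set n \<omega> \<subseteq> A \<and> inverse_descent_set n \<omega> \<subseteq> B}"
proof (rule antisym[OF card_young_le[OF A]])
  have A': "flip n K ` A \<subseteq> {1..<n} - K" using flip_range A by blast
  have 1: "flip n K ` D \<subseteq> A \<longleftrightarrow> D \<subseteq> flip n K ` A" if "D \<subseteq> {1..<n} - K" for D
    using that A flip_involution by (auto simp: subset_iff image_iff) metis+
  have 2: "flip n K ` D \<subseteq> flip n K ` A \<longleftrightarrow> D \<subseteq> A" if "D \<subseteq> {1..<n} - K" for D
    using that A flip_involution by (auto simp: subset_iff image_iff) metis+
  show "card {\<omega> \<in> young n K. flip n K ` descent_set n \<omega> \<subseteq> A \<and> inverse_descent_set n \<omega> \<subseteq> B}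
    \<le> card {\<omega> \<in> young n K. descent_set n \<omega> \<subseteq> A \<and> inverse_descent_set n \<omega> \<subseteq> B}"
    using card_young_le[OF A', of B] 1 2 young_descent_set by (simp cong: conj_cong)
qed

text \<open>Containment is sharpened to equality one coordinate at a time, first for the descent set
  and then for the inverse descent set.\<close>

lemma card_young_eq:
  "card {\<omega> \<in> young n K. (descent_set n \<omega>, inverse_descent_set n \<omega>) = t}
    = card {\<omega> \<in> young n K. (flip n K ` descent_set n \<omega>, inverse_descent_set n \<omega>) = t}"
proof -
  obtain A B where t: "t = (A, B)" by force
  let ?U = "{1..<n} - K" and ?D = "descent_set n" and ?I = "inverse_descent_set n"
  let ?F = "\<lambda>\<omega>. flip n K ` ?D \<omega>"
  have finU: "finite ?U" by simp
  have D: "?D \<omega> \<subseteq> ?U" "?F \<omega> \<subseteq> ?U" "?I \<omega> \<subseteq> ?U" if "\<omega> \<in> young n K" for \<omega>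
    using young_descent_set[OF that] young_inverse_descent_set[OF that] flip_range by blast+
  show ?thesis
  proof (cases "A \<subseteq> ?U \<and> B \<subseteq> ?U")
    case True
    \<comment> \<open>The bound \<open>B'\<close> stays arbitrary because the second inversion needs
      this equality for every subset of \<open>?U\<close>.\<close>
    have step: "card {\<omega> \<in> young n K. ?D \<omega> = A \<and> ?I \<omega> \<subseteq> B'} = card {\<omega> \<in> young n K. ?F \<omega> = A \<and> ?I \<omega> \<subseteq> B'}" for B'
      by (rule subset_sums_eqD[OF finU _ conjunct1[OF True],
            where f = "\<lambda>A. card {\<omega> \<in> young n K. ?D \<omega> = A \<and> ?I \<omega> \<subseteq> B'}"
              and g = "\<lambda>A. card {\<omega> \<in> young n K. ?F \<omega> = A \<and> ?I \<omega> \<subseteq> B'}"])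
        (simp only: card_subset_fibres[symmetric] finite_young finite_subset[OF _ finU] card_young_subset_eq)
    have step': "card {\<omega> \<in> young n K. ?I \<omega> \<subseteq> B' \<and> ?D \<omega> = A} = card {\<omega> \<in> young n K. ?I \<omega> \<subseteq> B' \<and> ?F \<omega> = A}" for B'
      using step[of B'] by (simp only: conj_commute)
    have "card {\<omega> \<in> young n K. ?I \<omega> = B \<and> ?D \<omega> = A} = card {\<omega> \<in> young n K. ?I \<omega> = B \<and> ?F \<omega> = A}"
      by (rule subset_sums_eqD[OF finU _ conjunct2[OF True],
            where f = "\<lambda>B. card {\<omega> \<in> young n K. ?I \<omega> = B \<and> ?D \<omega> = A}"
              and g = "\<lambda>B. card {\<omega> \<in> young n K. ?I \<omega> = B \<and> ?F \<omega> = A}"])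
        (simp only: card_subset_fibres[symmetric] finite_young finite_subset[OF _ finU] step')
    then show ?thesis by (simp add: t conj_commute)
  next
    case False
    then have "{\<omega> \<in> young n K. (?D \<omega>, ?I \<omega>) = t} = {}" "{\<omega> \<in> young n K. (?F \<omega>, ?I \<omega>) = t} = {}"
      using D unfolding t by blast+
    then show ?thesis by (simp only:)
  qed
qed

text \<open>The equality of joint distributions yields \<open>h\<close>. Its effect on descents is
  stated position by position, the form in which single descents of the mirror image are
  computed.\<close>

lemma young_bij:
  obtains h where "bij_betw h (young n K) (young n K)"
    "\<And>\<omega>. \<omega> \<in> young n K \<Longrightarrow> inverse_descent_set n (h \<omega>) = inverse_descent_set n \<omega>"
    "\<And>\<omega> i. \<omega> \<in> young n K \<Longrightarrow> i \<in> {1..<n} - K \<Longrightarrow> flip n K i \<in> descent_set n (h \<omega>) \<longleftrightarrow> i \<in> descent_set n \<omega>"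
proof -
  obtain h where h: "bij_betw h (young n K) (young n K)"
    "\<And>\<omega>. \<omega> \<in> young n K \<Longrightarrow> (flip n K ` descent_set n (h \<omega>), inverse_descent_set n (h \<omega>))
        = (descent_set n \<omega>, inverse_descent_set n \<omega>)"
    using bij_betw_of_equal_fibres[OF finite_young card_young_eq] by blast
  have "flip n K i \<in> descent_set n (h \<omega>) \<longleftrightarrow> i \<in> descent_set n \<omega>"
    if "\<omega> \<in> young n K" "i \<in> {1..<n} - K" for \<omega> i
  proof -
    have "h \<omega> \<in> young n K" using h(1) that(1) by (auto simp: bij_betw_def)
    then have "descent_set n (h \<omega>) \<subseteq> {1..<n} - K" by (rule young_descent_set)
    moreover have "flip n K ` descent_set n (h \<omega>) = descent_set n \<omega>" using h(2)[OF that(1)] by simp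
    moreover have "flip n K i \<in> D \<longleftrightarrow> i \<in> flip n K ` D" if "D \<subseteq> {1..<n} - K" for D
    proof
      assume "flip n K i \<in> D"
      then show "i \<in> flip n K ` D" using flip_involution[OF \<open>i \<in> {1..<n} - K\<close>] by (metis image_eqI)
    next
      assume "i \<in> flip n K ` D"
      then show "flip n K i \<in> D" using flip_involution that by (auto simp: subset_iff)
    qed
    ultimately show ?thesis by simp
  qed
  then show thesis using that[of h] h by simp
qed

end

section \<open>The mirror map\<close>

definition tail_rev :: "nat \<Rightarrow> nat \<Rightarrow> nat" where
  "tail_rev n i = (if i \<in> {2..n} then n + 2 - i else i)"

lemma tail_rev_involution: "tail_rev n (tail_rev n i) = i"
  by (auto simp: tail_rev_def)

lemma tail_rev_permutes: "tail_rev n permutes {1..n}"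
proof (rule bij_imp_permutes)
  show "bij_betw (tail_rev n) {1..n} {1..n}"
    by (rule bij_betw_byWitness[where f' = "tail_rev n"])
      (use tail_rev_involution in \<open>auto simp: tail_rev_def split: if_splits\<close>)
qed (auto simp: tail_rev_def)

text \<open>The cuts \<open>k - 1\<close> and \<open>k\<close> separate the letters below
  \<open>k\<close>, the letter \<open>k\<close> itself and the letters above \<open>k\<close>. The
  intersection discards the cuts 0 and \<open>n\<close>, which arise when \<open>k\<close> is the
  smallest or the largest letter.\<close>

context
  fixes n k :: nat and K :: "nat set"
  assumes k: "k \<in> {1..n}"
  defines "K \<equiv> {k - 1, k} \<inter> {1..<n}"
begin

lemma K_subset: "K \<subseteq> {1..<n}"
  by (simp add: K_def)

lemma same_block_cases:
  assumes "u \<in> {1..n}" "v \<in> {1..n}"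
  shows "same_block K u v \<longleftrightarrow> (u < k \<longleftrightarrow> v < k) \<and> (k < u \<longleftrightarrow> k < v)"
proof
  assume sb: "same_block K u v"
  have "u < k \<longleftrightarrow> v < k"
  proof (cases "k = 1")
    case False
    then have "k - 1 \<in> K" using k by (auto simp: K_def)
    then have "k - 1 < u \<longleftrightarrow> k - 1 < v" using sb by (auto simp: same_block_def)
    then show ?thesis using k by auto
  qed (use assms in auto)
  moreover have "k < u \<longleftrightarrow> k < v"
  proof (cases "k = n")
    case False
    then have "k \<in> K" using k by (auto simp: K_def)
    then show ?thesis using sb by (auto simp: same_block_def)
  qed (use assms in auto)
  ultimately show "(u < k \<longleftrightarrow> v < k) \<and> (k < u \<longleftrightarrow> k < v)" ..
qed (auto simp: K_def same_block_def)

lemma same_block_k: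
  assumes "same_block K u k" "u \<in> {1..n}"
  shows "u = k"
proof -
  have "\<not> u < k" "\<not> k < u" using same_block_cases[OF assms(2) k] assms(1) by simp_all
  then show ?thesis by simp
qed

text \<open>\<open>sorting \<pi>\<close> sends positions to positions: those of the letters below \<open>k\<close> to the front, then that
  of \<open>k\<close>, then those of the letters above \<open>k\<close>, keeping the order within each class.\<close>

definition sorting :: "(nat \<Rightarrow> nat) \<Rightarrow> nat \<Rightarrow> nat" where
  "sorting \<pi> = standardization n (label K \<circ> \<pi>)"

lemma sorting_permutes: "sorting \<pi> permutes {1..n}"
  by (simp only: sorting_def standardization_permutes)

lemma sorting_in: "sorting \<pi> i \<in> {1..n} \<longleftrightarrow> i \<in> {1..n}"
  by (rule permutes_in_image[OF sorting_permutes])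

text \<open>This writes the letters below \<open>k\<close> in their order of appearance, then
  \<open>k\<close>, then those above \<open>k\<close>. Thus \<open>\<pi>\<close> factors as
  \<open>unshuffle \<pi> \<circ> sorting \<pi>\<close>, separating the two subwords from the way
  they are shuffled.\<close>

definition unshuffle :: "(nat \<Rightarrow> nat) \<Rightarrow> nat \<Rightarrow> nat" where
  "unshuffle \<pi> = \<pi> \<circ> inv (sorting \<pi>)"

lemma sorting_less:
  assumes "i \<in> {1..n}" "j \<in> {1..n}" "same_block K (\<pi> i) (\<pi> j)" "i < j"
  shows "sorting \<pi> i < sorting \<pi> j"
  unfolding sorting_def using assms by (intro standardization_less) (auto simp: label_eq_iff)

lemma same_block_sorting:
  assumes "\<pi> permutes {1..n}" "i \<in> {1..n}"
  shows "same_block K (sorting \<pi> i) (\<pi> i)"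
  using standardization_label[OF mono_label assms, of K] by (simp add: sorting_def label_eq_iff)

lemma unshuffle_sorting: "unshuffle \<pi> (sorting \<pi> i) = \<pi> i"
  by (simp add: unshuffle_def permutes_inverses[OF sorting_permutes])

lemma unshuffle_young:
  assumes \<pi>: "\<pi> permutes {1..n}"
  shows "unshuffle \<pi> \<in> young n K"
proof -
  have "same_block K (unshuffle \<pi> i) i" if "i \<in> {1..n}" for i
  proof -
    have "inv (sorting \<pi>) i \<in> {1..n}" using that permutes_in_image[OF permutes_inv[OF sorting_permutes]] by blast
    from same_block_sorting[OF \<pi> this] show ?thesis
      by (simp add: unshuffle_def permutes_inverses[OF sorting_permutes] same_block_sym)
  qed
  moreover have "unshuffle \<pi> permutes {1..n}"
    unfolding unshuffle_def by (intro permutes_compose permutes_inv sorting_permutes \<pi>)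
  ultimately show ?thesis by (simp add: young_def)
qed

lemma sorting_inv_less:
  assumes \<pi>: "\<pi> permutes {1..n}" and xy: "x \<in> {1..n}" "y \<in> {1..n}" "same_block K x y" "x < y"
  shows "inv (sorting \<pi>) x < inv (sorting \<pi>) y"
proof -
  define i j where "i = inv (sorting \<pi>) x" and "j = inv (sorting \<pi>) y"
  have s: "sorting \<pi> i = x" "sorting \<pi> j = y" by (simp_all add: i_def j_def permutes_inverses[OF sorting_permutes])
  then have ij: "i \<in> {1..n}" "j \<in> {1..n}" using xy sorting_in by metis+
  have "same_block K (\<pi> j) (\<pi> i)"
    using same_block_sorting[OF \<pi> ij(1)] same_block_sorting[OF \<pi> ij(2)] xy(3) s
    by (simp add: label_eq_iff[symmetric])
  then have "\<not> j < i" using sorting_less[OF ij(2,1)] s xy(4) by fastforce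
  moreover have "i \<noteq> j" using s xy(4) by auto
  ultimately show ?thesis by (simp add: i_def j_def)
qed

text \<open>Anything sorted strictly between the two images would belong to the same class, and so
  would have to stand strictly between positions \<open>i\<close> and \<open>i + 1\<close>.\<close>

lemma sorting_Suc:
  assumes \<pi>: "\<pi> permutes {1..n}" and i: "i \<in> {1..n}" "i + 1 \<in> {1..n}" "same_block K (\<pi> i) (\<pi> (i + 1))"
  shows "sorting \<pi> (i + 1) = sorting \<pi> i + 1" "sorting \<pi> i \<in> {1..<n} - K"
proof -
  have less: "sorting \<pi> i < sorting \<pi> (i + 1)" by (rule sorting_less[OF i]) simp
  have s: "sorting \<pi> i \<in> {1..n}" "sorting \<pi> (i + 1) \<in> {1..n}" using i sorting_in by blast+
  have sb: "same_block K (sorting \<pi> i) (sorting \<pi> (i + 1))"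
    using same_block_sorting[OF \<pi> i(1)] same_block_sorting[OF \<pi> i(2)] i(3)
    by (simp add: label_eq_iff[symmetric])
  show eq: "sorting \<pi> (i + 1) = sorting \<pi> i + 1"
  proof (rule ccontr)
    assume "sorting \<pi> (i + 1) \<noteq> sorting \<pi> i + 1"
    then have lt: "sorting \<pi> i < sorting \<pi> i + 1" "sorting \<pi> i + 1 < sorting \<pi> (i + 1)" using less by auto
    then have m: "sorting \<pi> i + 1 \<in> {1..n}" using s by auto
    have "same_block K (sorting \<pi> i) (sorting \<pi> i + 1)" "same_block K (sorting \<pi> i + 1) (sorting \<pi> (i + 1))"
      using sb lt unfolding same_block_def by (meson less_trans)+
    then have "i < inv (sorting \<pi>) (sorting \<pi> i + 1)" "inv (sorting \<pi>) (sorting \<pi> i + 1) < i + 1"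
      using sorting_inv_less[OF \<pi> s(1) m _ lt(1)] sorting_inv_less[OF \<pi> m s(2) _ lt(2)]
      by (simp_all add: permutes_inverses[OF sorting_permutes])
    then show False by simp
  qed
  have "sorting \<pi> i \<notin> K" using sb eq by (auto simp: same_block_def)
  then show "sorting \<pi> i \<in> {1..<n} - K" using s eq by auto
qed

lemma sorting_1:
  assumes \<pi>: "\<pi> permutes {1..n}" "\<pi> 1 = k"
  shows "sorting \<pi> 1 = k"
proof -
  have 1: "1 \<in> {1..n}" using k by auto
  show ?thesis using same_block_k[of "sorting \<pi> 1"] same_block_sorting[OF \<pi>(1) 1] \<pi>(2) sorting_in[of \<pi> 1] 1 by simp
qed

section \<open>The mirror map built from a fixed reflecting bijection \<open>h\<close>\<close>

context
  fixes h :: "(nat \<Rightarrow> nat) \<Rightarrow> nat \<Rightarrow> nat"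
  assumes h_bij: "bij_betw h (young n K) (young n K)"
    and h_inverse_descent_set:
      "\<And>\<omega>. \<omega> \<in> young n K \<Longrightarrow> inverse_descent_set n (h \<omega>) = inverse_descent_set n \<omega>"
    and h_descent_set: "\<And>\<omega> i. \<omega> \<in> young n K \<Longrightarrow> i \<in> {1..<n} - K \<Longrightarrow>
      flip n K i \<in> descent_set n (h \<omega>) \<longleftrightarrow> i \<in> descent_set n \<omega>"
begin

text \<open>The class of each position is reflected by \<open>tail_rev\<close>. This alone would
  also read each class backwards; \<open>block_rev\<close> undoes that, so the mirror image shuffles
  the subwords of \<open>h (unshuffle \<pi>)\<close> read from left to right.\<close>

definition mirror :: "(nat \<Rightarrow> nat) \<Rightarrow> nat \<Rightarrow> nat" where
  "mirror \<pi> = h (unshuffle \<pi>) \<circ> block_rev n K \<circ> sorting \<pi> \<circ> tail_rev n"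

lemma h_young: "\<omega> \<in> young n K \<Longrightarrow> h \<omega> \<in> young n K"
  using h_bij by (auto simp: bij_betw_def)

lemma h_unshuffle: "\<pi> permutes {1..n} \<Longrightarrow> h (unshuffle \<pi>) \<in> young n K"
  by (intro h_young unshuffle_young)

lemma mirror_permutes:
  assumes "\<pi> permutes {1..n}"
  shows "mirror \<pi> permutes {1..n}"
proof -
  have "h (unshuffle \<pi>) permutes {1..n}" using h_unshuffle[OF assms] by (simp add: young_def)
  then show ?thesis
    unfolding mirror_def
    by (intro permutes_compose tail_rev_permutes sorting_permutes block_rev_permutes[OF K_subset])
qed

lemma mirror_tail_rev:
  "mirror \<pi> (tail_rev n i) = h (unshuffle \<pi>) (block_rev n K (sorting \<pi> i))"
  by (simp add: mirror_def tail_rev_involution)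

lemma same_block_mirror:
  assumes \<pi>: "\<pi> permutes {1..n}" and i: "i \<in> {1..n}"
  shows "same_block K (mirror \<pi> (tail_rev n i)) (\<pi> i)"
proof -
  have "block_rev n K (sorting \<pi> i) \<in> {1..n}" using block_rev_in[OF K_subset] sorting_in i by blast
  then have "same_block K (mirror \<pi> (tail_rev n i)) (block_rev n K (sorting \<pi> i))"
    using h_unshuffle[OF \<pi>] unfolding young_def mirror_tail_rev by blast
  then show ?thesis
    using same_block_block_rev[OF K_subset] same_block_sorting[OF \<pi> i] by (blast intro: same_block_trans)
qed

lemma mirror_1:
  assumes \<pi>: "\<pi> permutes {1..n}" "\<pi> 1 = k"
  shows "mirror \<pi> 1 = k"
proof -
  have 1: "1 \<in> {1..n}" "tail_rev n 1 = 1" using k by (auto simp: tail_rev_def)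
  then have "same_block K (mirror \<pi> 1) k" using same_block_mirror[OF \<pi>(1) 1(1)] \<pi>(2) by simp
  moreover have "mirror \<pi> 1 \<in> {1..n}" using permutes_in_image[OF mirror_permutes[OF \<pi>(1)]] 1 by blast
  ultimately show ?thesis by (rule same_block_k)
qed

text \<open>The positions of the three classes can be read off the mirror image, which gives
  \<open>sorting \<pi>\<close>. Cancelling the position maps leaves
  \<open>h (unshuffle \<pi>)\<close>, and \<open>h\<close> is injective.\<close>

lemma mirror_inj: "inj_on mirror {\<pi>. \<pi> permutes {1..n}}"
proof (rule inj_onI)
  fix \<pi> \<rho> assume "\<pi> \<in> {\<pi>. \<pi> permutes {1..n}}" "\<rho> \<in> {\<pi>. \<pi> permutes {1..n}}" and eq: "mirror \<pi> = mirror \<rho>"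
  then have \<pi>: "\<pi> permutes {1..n}" and \<rho>: "\<rho> permutes {1..n}" by auto
  have "same_block K (\<pi> i) (\<rho> i)" if "i \<in> {1..n}" for i
    using same_block_mirror[OF \<pi> that] same_block_mirror[OF \<rho> that] eq
    by (simp add: label_eq_iff[symmetric])
  then have sorting: "sorting \<pi> = sorting \<rho>"
    unfolding sorting_def by (intro standardization_cong) (simp add: label_eq_iff)
  have "h (unshuffle \<pi>) = h (unshuffle \<rho>)"
  proof
    fix x
    have "block_rev n K (sorting \<pi> (inv (sorting \<pi>) (block_rev n K x))) = x"
      by (simp add: permutes_inverses[OF sorting_permutes] block_rev_involution[OF K_subset])
    then show "h (unshuffle \<pi>) x = h (unshuffle \<rho>) x"
      using mirror_tail_rev[of \<pi> "inv (sorting \<pi>) (block_rev n K x)"]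
        mirror_tail_rev[of \<rho> "inv (sorting \<pi>) (block_rev n K x)"] eq sorting by simp
  qed
  then have "unshuffle \<pi> = unshuffle \<rho>"
    using h_bij unshuffle_young[OF \<pi>] unshuffle_young[OF \<rho>] by (auto simp: bij_betw_def inj_on_def)
  then show "\<pi> = \<rho>" using unshuffle_sorting sorting by (metis ext)
qed

text \<open>For neighbouring letters in one class, the relative order in \<open>\<pi>\<close> is
  that in \<open>unshuffle \<pi>\<close>, and the order in the mirror image is that in
  \<open>h (unshuffle \<pi>)\<close>; \<open>h\<close> preserves inverse descents. If one of the two
  letters is \<open>k\<close>, the order is forced, since \<open>k\<close> stands first in both
  words.\<close>

lemma mirror_inverse_descent_set:
  assumes \<pi>: "\<pi> permutes {1..n}" "\<pi> 1 = k"
  shows "inverse_descent_set n (mirror \<pi>) = inverse_descent_set n \<pi>"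
proof -
  let ?\<omega> = "unshuffle \<pi>"
  let ?g = "\<lambda>x. tail_rev n (inv (sorting \<pi>) (block_rev n K x))"
  note M = mirror_permutes[OF \<pi>(1)]
  have perm: "?\<omega> permutes {1..n}" "h ?\<omega> permutes {1..n}"
    using unshuffle_young[OF \<pi>(1)] h_unshuffle[OF \<pi>(1)] by (simp_all add: young_def)
  have inv_\<pi>: "inv \<pi> v = inv (sorting \<pi>) (inv ?\<omega> v)" for v
    by (rule permutes_inv_eq[OF \<pi>(1), THEN iffD2])
      (use unshuffle_sorting[of \<pi> "inv (sorting \<pi>) (inv ?\<omega> v)"] in
        \<open>simp add: permutes_inverses[OF sorting_permutes] permutes_inverses[OF perm(1)]\<close>)
  have inv_M: "inv (mirror \<pi>) v = ?g (inv (h ?\<omega>) v)" for v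
    by (rule permutes_inv_eq[OF M, THEN iffD2])
      (simp add: mirror_tail_rev permutes_inverses[OF sorting_permutes] permutes_inverses[OF perm(2)]
        block_rev_involution[OF K_subset])
  \<comment> \<open>Here \<open>?g\<close> sends a place of \<open>h ?\<omega>\<close> to the
    position of its letter in the mirror image. The two reversals cancel, provided position 1, which
    \<open>tail_rev\<close> fixes, is avoided; that position belongs to \<open>k\<close>.\<close>
  have g_less: "?g x < ?g y"
    if xy: "x \<in> {1..n}" "y \<in> {1..n}" "same_block K x y" "x < y" "x \<noteq> k" "y \<noteq> k" for x y
  proof -
    have less: "block_rev n K y < block_rev n K x" by (rule block_rev_less[OF K_subset xy(1-4)])
    have r: "block_rev n K x \<in> {1..n}" "block_rev n K y \<in> {1..n}" using block_rev_in[OF K_subset] xy by blast+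
    have sb: "same_block K (block_rev n K y) (block_rev n K x)" "same_block K (block_rev n K y) y"
      using same_block_block_rev[OF K_subset, of x] same_block_block_rev[OF K_subset, of y] xy(3)
      by (simp_all add: label_eq_iff[symmetric])
    let ?p = "inv (sorting \<pi>) (block_rev n K y)" and ?q = "inv (sorting \<pi>) (block_rev n K x)"
    have "?p < ?q" by (rule sorting_inv_less[OF \<pi>(1) r(2,1) sb(1) less])
    moreover have "?p \<in> {1..n}" "?q \<in> {1..n}" using r permutes_in_image[OF permutes_inv[OF sorting_permutes]] by blast+
    moreover have "?p \<noteq> 1"
    proof
      assume "?p = 1"
      then have "block_rev n K y = k"
        using sorting_1[OF \<pi>] permutes_inverses(1)[OF sorting_permutes, of \<pi> "block_rev n K y"] by simp
      then show False using sb(2) xy(2,6) same_block_k same_block_sym by metis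
    qed
    ultimately show ?thesis by (auto simp: tail_rev_def)
  qed
  have pos: "inv \<tau> v \<in> {1..n} \<and> same_block K (inv \<tau> v) v" if "\<tau> \<in> young n K" "v \<in> {1..n}" for \<tau> v
  proof -
    have \<tau>: "\<tau> permutes {1..n}" using that by (simp add: young_def)
    have "inv \<tau> v \<in> {1..n}" using that permutes_in_image[OF permutes_inv[OF \<tau>]] by blast
    moreover from this have "same_block K (\<tau> (inv \<tau> v)) (inv \<tau> v)" using that(1) unfolding young_def by blast
    ultimately show ?thesis by (simp add: permutes_inverses[OF \<tau>] same_block_sym)
  qed
  have "inv (mirror \<pi>) (v + 1) < inv (mirror \<pi>) v \<longleftrightarrow> inv \<pi> (v + 1) < inv \<pi> v"
    if v: "v \<in> {1..<n}" for v
  proof -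
    have v': "v \<in> {1..n}" "v + 1 \<in> {1..n}" using v by auto
    have inv_k: "inv \<pi> k = 1" "inv (mirror \<pi>) k = 1"
      using \<pi> M mirror_1[OF \<pi>] by (auto intro: permutes_inv_eq[THEN iffD2])
    have inv_pos: "inv \<pi> u \<ge> 1" "inv (mirror \<pi>) u \<ge> 1" if "u \<in> {1..n}" for u
      using permutes_in_image[OF permutes_inv[OF \<pi>(1)], of u] permutes_in_image[OF permutes_inv[OF M], of u] that
      by auto
    consider "v = k" | "v + 1 = k" | "v \<noteq> k" "v + 1 \<noteq> k" by blast
    then show ?thesis
    proof cases
      case 1
      then show ?thesis using inv_k inv_pos[OF v'(2)] by simp
    next
      case 2
      have "inv \<pi> v \<noteq> inv \<pi> k" "inv (mirror \<pi>) v \<noteq> inv (mirror \<pi>) k"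
        using permutes_inj[OF permutes_inv[OF \<pi>(1)]] permutes_inj[OF permutes_inv[OF M]] 2
        by (auto simp: inj_eq)
      then show ?thesis using inv_k inv_pos[OF v'(1)] 2 by simp
    next
      case 3
      have sb: "same_block K v (v + 1)" using 3 v' by (subst same_block_cases) auto
      have x: "inv \<tau> v \<in> {1..n}" "inv \<tau> (v + 1) \<in> {1..n}" "same_block K (inv \<tau> v) (inv \<tau> (v + 1))"
        "inv \<tau> v \<noteq> k" "inv \<tau> (v + 1) \<noteq> k" "inv \<tau> v \<noteq> inv \<tau> (v + 1)" if "\<tau> \<in> young n K" for \<tau>
      proof -
        have \<tau>: "\<tau> permutes {1..n}" using that by (simp add: young_def)
        show "inv \<tau> v \<noteq> inv \<tau> (v + 1)"
          using permutes_inj[OF permutes_inv[OF \<tau>]] by (simp add: inj_eq)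
        show "inv \<tau> v \<in> {1..n}" "inv \<tau> (v + 1) \<in> {1..n}" using pos[OF that] v' by blast+
        show "same_block K (inv \<tau> v) (inv \<tau> (v + 1))"
          using pos[OF that v'(1)] pos[OF that v'(2)] sb by (simp add: label_eq_iff[symmetric])
        show "inv \<tau> v \<noteq> k" "inv \<tau> (v + 1) \<noteq> k"
          using pos[OF that v'(1)] pos[OF that v'(2)] same_block_k[of v] same_block_k[of "v + 1"] same_block_sym v' 3
          by metis+
      qed
      note a = x[OF unshuffle_young[OF \<pi>(1)]] and b = x[OF h_unshuffle[OF \<pi>(1)]]
      have "inv \<pi> (v + 1) < inv \<pi> v \<longleftrightarrow> inv ?\<omega> (v + 1) < inv ?\<omega> v"
        unfolding inv_\<pi> using a sorting_inv_less[OF \<pi>(1) a(1,2,3)] sorting_inv_less[OF \<pi>(1) a(2,1) same_block_sym[OF a(3)]]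
        by (cases "inv ?\<omega> v" "inv ?\<omega> (v + 1)" rule: linorder_cases) auto
      moreover have "inv (mirror \<pi>) (v + 1) < inv (mirror \<pi>) v \<longleftrightarrow> inv (h ?\<omega>) (v + 1) < inv (h ?\<omega>) v"
        unfolding inv_M using b g_less[OF b(1,2,3)] g_less[OF b(2,1) same_block_sym[OF b(3)]]
        by (cases "inv (h ?\<omega>) v" "inv (h ?\<omega>) (v + 1)" rule: linorder_cases) auto
      moreover have "inv (h ?\<omega>) (v + 1) < inv (h ?\<omega>) v \<longleftrightarrow> inv ?\<omega> (v + 1) < inv ?\<omega> v"
        using h_inverse_descent_set[OF unshuffle_young[OF \<pi>(1)]] v
        by (auto simp: inverse_descent_set_def set_eq_iff)
      ultimately show ?thesis by blast
    qed
  qed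
  then show ?thesis by (auto simp: inverse_descent_set_def)
qed

text \<open>Up to reflecting positions, mirroring keeps the descents between letters on the same
  side of \<open>k\<close>, and moves the descent into a maximal run of letters below \<open>k\<close> from its beginning
  to its end.\<close>

lemma mirror_descent:
  assumes \<pi>: "\<pi> permutes {1..n}" "\<pi> 1 = k" and i: "i \<in> {1..n}"
  defines "e \<equiv> \<lambda>i. of_bool (i \<le> n \<and> \<pi> i < k)"
  shows "(of_bool (n + 1 - i \<in> descent_set n (mirror \<pi>)) :: int)
    = of_bool (i \<in> descent_set n \<pi>) + e i - e (i + 1)"
proof -
  note M = mirror_permutes[OF \<pi>(1)]
  have cls: "mirror \<pi> (tail_rev n j) < k \<longleftrightarrow> \<pi> j < k" "k < mirror \<pi> (tail_rev n j) \<longleftrightarrow> k < \<pi> j"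
    if j: "j \<in> {1..n}" for j
  proof -
    have "mirror \<pi> (tail_rev n j) \<in> {1..n}" "\<pi> j \<in> {1..n}"
      using j permutes_in_image[OF M] permutes_in_image[OF tail_rev_permutes] permutes_in_image[OF \<pi>(1)] by blast+
    then show "mirror \<pi> (tail_rev n j) < k \<longleftrightarrow> \<pi> j < k" "k < mirror \<pi> (tail_rev n j) \<longleftrightarrow> k < \<pi> j"
      using same_block_mirror[OF \<pi>(1) j] same_block_cases by blast+
  qed
  have ne: "\<pi> j \<noteq> k" if "j \<noteq> 1" for j
    using that \<pi> permutes_inj[OF \<pi>(1)] by (auto simp: inj_eq)
  \<comment> \<open>The pair \<open>i\<close>, \<open>i + 1\<close> is reflected to
    \<open>n + 2 - i\<close>, \<open>n + 1 - i\<close> only away from the first letter. For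
    \<open>i = 1\<close> the reflected index is \<open>n\<close>, never a descent, and for
    \<open>i = n\<close> it is 1, where the first letter \<open>k\<close> meets the mirrored last
    letter.\<close>
  consider "i = 1" | "i \<noteq> 1" "i = n" | "i \<in> {2..<n}" using i by force
  then show ?thesis
  proof cases
    case 1
    then show ?thesis using \<pi>(2) i by (auto simp: descent_set_def e_def of_bool_def)
  next
    case 2
    have "tail_rev n n = 2" using 2 i by (auto simp: tail_rev_def)
    then have "mirror \<pi> 2 < k \<longleftrightarrow> \<pi> n < k" using cls(1)[of n] i 2 by simp
    then show ?thesis using 2 i mirror_1[OF \<pi>] by (auto simp: descent_set_def e_def of_bool_def numeral_2_eq_2)
  next
    case 3
    have t: "tail_rev n i = n + 1 - i + 1" "tail_rev n (i + 1) = n + 1 - i"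
      using 3 by (auto simp: tail_rev_def)
    have D: "n + 1 - i \<in> descent_set n (mirror \<pi>) \<longleftrightarrow> mirror \<pi> (tail_rev n i) < mirror \<pi> (tail_rev n (i + 1))"
      unfolding t using 3 by (auto simp: descent_set_def)
    have D': "i \<in> descent_set n \<pi> \<longleftrightarrow> \<pi> (i + 1) < \<pi> i" using 3 by (auto simp: descent_set_def)
    have i1: "i + 1 \<in> {1..n}" using 3 by auto
    have range: "\<pi> i \<in> {1..n}" "\<pi> (i + 1) \<in> {1..n}" using i i1 permutes_in_image[OF \<pi>(1)] by blast+
    have nk: "\<pi> i \<noteq> k" "\<pi> (i + 1) \<noteq> k" using ne 3 by auto
    have e: "e i = of_bool (\<pi> i < k)" "e (i + 1) = of_bool (\<pi> (i + 1) < k)" using i i1 by (auto simp: e_def)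
    show ?thesis
    proof (cases "\<pi> i < k \<longleftrightarrow> \<pi> (i + 1) < k")
      case True
      then have sb: "same_block K (\<pi> i) (\<pi> (i + 1))" using nk by (subst same_block_cases[OF range]) auto
      \<comment> \<open>Both letters lie in one subword, at places \<open>m\<close> and
        \<open>m + 1\<close>. Their mirrored counterparts occupy the flipped pair, where
        \<open>h\<close> has placed a descent exactly if there was one at \<open>m\<close>.\<close>
      define m where "m = sorting \<pi> i"
      note s = sorting_Suc[OF \<pi>(1) i i1 sb, folded m_def]
      have "n + 1 - i \<in> descent_set n (mirror \<pi>) \<longleftrightarrow>
          h (unshuffle \<pi>) (flip n K m + 1) < h (unshuffle \<pi>) (flip n K m)"
        unfolding D mirror_tail_rev using s flip_range(2)[OF K_subset s(2)] by (simp add: flip_def m_def[symmetric])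
      also have "\<dots> \<longleftrightarrow> flip n K m \<in> descent_set n (h (unshuffle \<pi>))"
        using flip_range(1)[OF K_subset s(2)] by (auto simp: descent_set_def)
      also have "\<dots> \<longleftrightarrow> m \<in> descent_set n (unshuffle \<pi>)"
        by (rule h_descent_set[OF unshuffle_young[OF \<pi>(1)] s(2)])
      also have "\<dots> \<longleftrightarrow> unshuffle \<pi> (sorting \<pi> (i + 1)) < unshuffle \<pi> (sorting \<pi> i)"
        using s by (auto simp: descent_set_def m_def)
      finally show ?thesis unfolding D' e using True by (simp add: unshuffle_sorting)
    next
      \<comment> \<open>The letters lie on opposite sides of \<open>k\<close>, so the classes alone
        decide both comparisons.\<close>
      case False
      then show ?thesis
        using cls[OF i] cls[OF i1] nk unfolding D D' e by (auto simp: of_bool_def)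
    qed
  qed
qed

text \<open>Summing \<open>mirror_descent\<close> with weight 1 makes the differences of
  \<open>e\<close> telescope to 0. With weight \<open>n + 1 - i\<close>, summation by parts turns
  them into minus the number of letters below \<open>k\<close>.\<close>

lemma mirror_des_MAJ:
  assumes \<pi>: "\<pi> permutes {1..n}" "\<pi> 1 = k"
  shows "des n (mirror \<pi>) = des n \<pi>"
    and "int (MAJ n (mirror \<pi>)) = (int n + 1) * int (des n \<pi>) - int (MAJ n \<pi>) - (int k - 1)"
proof -
  define e :: "nat \<Rightarrow> int" where "e i = of_bool (i \<le> n \<and> \<pi> i < k)" for i
  define d :: "nat \<Rightarrow> int" where "d i = of_bool (i \<in> descent_set n \<pi>)" for i
  have n: "1 \<le> n" using k by auto
  \<comment> \<open>The sum includes the index \<open>n\<close>, where there is never a descent, so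
    that its range is symmetric under \<open>i\<close> to \<open>n + 1 - i\<close>.\<close>
  have sum_des: "sum f (descent_set n \<tau>) = (\<Sum>i = 1..n. of_bool (i \<in> descent_set n \<tau>) * f i)"
    for f :: "nat \<Rightarrow> int" and \<tau>
  proof -
    have "descent_set n \<tau> = {i \<in> {1..n}. i \<in> descent_set n \<tau>}" by (auto simp: descent_set_def)
    then have "sum f (descent_set n \<tau>) = sum f {i \<in> {1..n}. i \<in> descent_set n \<tau>}" by simp
    also have "\<dots> = (\<Sum>i = 1..n. of_bool (i \<in> descent_set n \<tau>) * f i)"
      by (simp only: sum.inter_filter[OF finite_atLeastAtMost]) (intro sum.cong refl, simp)
    finally show ?thesis .
  qed
  have mirror: "sum f (descent_set n (mirror \<pi>)) = (\<Sum>i = 1..n. (d i + e i - e (i + 1)) * f (n + 1 - i))"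
    for f :: "nat \<Rightarrow> int"
  proof -
    have "sum f (descent_set n (mirror \<pi>))
        = (\<Sum>i = 1..n. of_bool (n + 1 - i \<in> descent_set n (mirror \<pi>)) * f (n + 1 - i))"
      unfolding sum_des by (subst sum.atLeastAtMost_rev) (simp add: add.commute)
    also have "\<dots> = (\<Sum>i = 1..n. (d i + e i - e (i + 1)) * f (n + 1 - i))"
      by (intro sum.cong refl) (simp only: mirror_descent[OF \<pi>] d_def e_def)
    finally show ?thesis .
  qed
  have e_ends: "e 1 = 0" "e (n + 1) = 0" using \<pi> by (auto simp: e_def)
  have sum_e: "(\<Sum>i = 1..n. e i) = int k - 1"
  proof -
    have "(\<Sum>i = 1..n. e i) = int (card {i \<in> {1..n}. \<pi> i < k})"
      by (simp add: e_def Int_def conj_commute)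
    then show ?thesis using card_permutes_less[OF \<pi>(1) k] k by simp
  qed
  define g where "g i = e i - e (i + 1)" for i
  have tel: "(\<Sum>i = 1..m. g i) = e 1 - e (m + 1)" for m
    by (induction m) (auto simp: g_def)
  have tel': "(\<Sum>i = 1..m. int i * g i) = (\<Sum>i = 1..m. e i) - int m * e (m + 1)" for m
    by (induction m) (auto simp: g_def algebra_simps)
  have des: "int (des n \<pi>) = (\<Sum>i = 1..n. d i)" "int (MAJ n \<pi>) = (\<Sum>i = 1..n. d i * int i)"
    using sum_des[of "\<lambda>_. 1" \<pi>] sum_des[of int \<pi>] by (simp_all add: des_def MAJ_def d_def)
  have "int (des n (mirror \<pi>)) = (\<Sum>i = 1..n. d i + g i)"
    using mirror[of "\<lambda>_. 1"] by (simp add: des_def g_def algebra_simps)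
  also have "\<dots> = int (des n \<pi>)" unfolding sum.distrib tel by (simp add: des e_ends[simplified])
  finally show "des n (mirror \<pi>) = des n \<pi>" by simp
  have "int (MAJ n (mirror \<pi>)) = (\<Sum>i = 1..n. (d i + e i - e (i + 1)) * int (n + 1 - i))"
    using mirror[of int] by (simp add: MAJ_def)
  also have "\<dots> = (\<Sum>i = 1..n. (int n + 1) * d i + (int n + 1) * g i - d i * int i - int i * g i)"
    by (intro sum.cong refl) (auto simp: g_def algebra_simps)
  also have "\<dots> = (int n + 1) * int (des n \<pi>) - int (MAJ n \<pi>) - (int k - 1)"
    unfolding sum_subtractf sum.distrib sum_distrib_left[symmetric] tel tel' sum_e des e_ends by simp
  finally show "int (MAJ n (mirror \<pi>)) = (int n + 1) * int (des n \<pi>) - int (MAJ n \<pi>) - (int k - 1)" .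
qed

end

text \<open>Among permutations with first letter \<open>k\<close>, \<open>STAT_eq\<close> expresses
  \<open>STAT\<close> as \<open>(n + 1) des - (k - 1) - MAJ\<close>, which is exactly the value of
  \<open>MAJ\<close> after mirroring. The relation is symmetric in \<open>MAJ\<close> and
  \<open>STAT\<close>, so the other coordinate follows.\<close>

lemma MAJ_STAT_swap:
  obtains \<Psi> where "inj_on \<Psi> {\<pi>. \<pi> permutes {1..n}}"
    "\<And>\<pi>. \<pi> permutes {1..n} \<Longrightarrow> \<pi> 1 = k \<Longrightarrow> \<Psi> \<pi> permutes {1..n} \<and> \<Psi> \<pi> 1 = k
      \<and> des n (\<Psi> \<pi>) = des n \<pi> \<and> inverse_descent_set n (\<Psi> \<pi>) = inverse_descent_set n \<pi>
      \<and> MAJ n (\<Psi> \<pi>) = STAT n \<pi> \<and> STAT n (\<Psi> \<pi>) = MAJ n \<pi>"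
proof -
  obtain h where h: "bij_betw h (young n K) (young n K)"
    "\<And>\<omega>. \<omega> \<in> young n K \<Longrightarrow> inverse_descent_set n (h \<omega>) = inverse_descent_set n \<omega>"
    "\<And>\<omega> i. \<omega> \<in> young n K \<Longrightarrow> i \<in> {1..<n} - K \<Longrightarrow> flip n K i \<in> descent_set n (h \<omega>) \<longleftrightarrow> i \<in> descent_set n \<omega>"
    using young_bij[OF K_subset] by blast
  have n: "1 \<le> n" using k by simp
  show thesis
  proof (rule that[of "mirror h"])
    show "inj_on (mirror h) {\<pi>. \<pi> permutes {1..n}}" by (rule mirror_inj[OF h])
    fix \<pi> assume \<pi>: "\<pi> permutes {1..n}" "\<pi> 1 = k"
    note M = mirror_permutes[OF h \<pi>(1)] mirror_1[OF h \<pi>] and dm = mirror_des_MAJ[OF h \<pi>]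
    have "int (STAT n (mirror h \<pi>)) = int (MAJ n \<pi>)" "int (MAJ n (mirror h \<pi>)) = int (STAT n \<pi>)"
      using STAT_eq[OF M(1) n] STAT_eq[OF \<pi>(1) n] dm M(2) \<pi>(2) by simp_all
    then show "mirror h \<pi> permutes {1..n} \<and> mirror h \<pi> 1 = k
      \<and> des n (mirror h \<pi>) = des n \<pi> \<and> inverse_descent_set n (mirror h \<pi>) = inverse_descent_set n \<pi>
      \<and> MAJ n (mirror h \<pi>) = STAT n \<pi> \<and> STAT n (mirror h \<pi>) = MAJ n \<pi>"
      using M dm(1) mirror_inverse_descent_set[OF h \<pi>] by simp
  qed
qed

end

section \<open>The equidistribution\<close>

theorem theorem1p3:
  fixes n d f a b :: nat and S :: "nat set"
  assumes "n \<ge> 1"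
  shows "card {\<pi> \<in> perms n.
            (des n \<pi>, inverse_descent_set n \<pi>, first_letter \<pi>, MAJ n \<pi>, STAT n \<pi>) = (d, S, f, a, b)}
       = card {\<pi> \<in> perms n.
            (des n \<pi>, inverse_descent_set n \<pi>, first_letter \<pi>, STAT n \<pi>, MAJ n \<pi>) = (d, S, f, a, b)}"
    (is "card (?X a b) = card (?Y a b)")
proof (cases "f \<in> {1..n}")
  case True
  obtain \<Psi> where \<Psi>: "inj_on \<Psi> {\<pi>. \<pi> permutes {1..n}}"
    "\<And>\<pi>. \<pi> permutes {1..n} \<Longrightarrow> \<pi> 1 = f \<Longrightarrow> \<Psi> \<pi> permutes {1..n} \<and> \<Psi> \<pi> 1 = f
      \<and> des n (\<Psi> \<pi>) = des n \<pi> \<and> inverse_descent_set n (\<Psi> \<pi>) = inverse_descent_set n \<pi>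
      \<and> MAJ n (\<Psi> \<pi>) = STAT n \<pi> \<and> STAT n (\<Psi> \<pi>) = MAJ n \<pi>"
    using MAJ_STAT_swap[OF True] by blast
  have le: "card (?X a b) \<le> card (?Y a b)" for a b
  proof (rule card_inj_on_le[of \<Psi>])
    show "inj_on \<Psi> (?X a b)" by (rule inj_on_subset[OF \<Psi>(1)]) (auto simp: perms_def)
    show "\<Psi> ` ?X a b \<subseteq> ?Y a b"
    proof
      fix \<rho> assume "\<rho> \<in> \<Psi> ` ?X a b"
      then obtain \<pi> where \<pi>: "\<rho> = \<Psi> \<pi>" "\<pi> \<in> ?X a b" by blast
      then have "\<pi> permutes {1..n}" "\<pi> 1 = f" by (simp_all add: perms_def first_letter_def)
      from \<Psi>(2)[OF this] \<pi> show "\<rho> \<in> ?Y a b" by (simp add: perms_def first_letter_def)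
    qed
    show "finite (?Y a b)"
      by (rule finite_subset[OF _ finite_permutations[of "{1..n}"]]) (auto simp: perms_def)
  qed
  \<comment> \<open>Exchanging \<open>a\<close> and \<open>b\<close> interchanges the two sets, so
    the inequality obtained from the injection, used twice, gives equality.\<close>
  have "?Y a b = ?X b a" "?X a b = ?Y b a" by auto
  then show ?thesis using le[of a b] le[of b a] by (intro antisym) simp_all
next
  case False
  have "first_letter \<pi> \<in> {1..n}" if "\<pi> \<in> perms n" for \<pi>
    using that permutes_in_image[of \<pi> "{1..n}" 1] assms by (auto simp: perms_def first_letter_def)
  then have "?X a b = {}" "?Y a b = {}" using False by blast+
  then show ?thesis by (simp only:)
qed

end
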